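(* Let $\Phi$ be a root system of type $\mathrm A_n$ or $\mathrm D_n$ with simple system $\Pi$. If $\alpha\in\Pi$ is a leaf of the Dynkin diagram of $\Phi$, then $$h_\Phi\, n-h_{\Phi_\alpha}(n-1)=2\,\frac{|W_\alpha|}{|W_{\widetilde N[\alpha]}|}.$$
   Context: $h_\Psi$ denotes the Coxeter number of the irreducible root system $\Psi$. $\Phi_\alpha$ is the root subsystem generated by $\Pi\setminus\{\alpha\}$ (irreducible of rank $n-1$ since $\alpha$ is a leaf; for $n=1$ it is empty and the term $h_{\Phi_\alpha}(n-1)$ is read as $0$). For $X\subseteq\Pi$, $W_X$ is the subgroup of the Weyl group generated by the reflections $s_\beta$ with $\beta\in\Pi\setminus X$; $W_\alpha=W_{\{\alpha\}}$. $\widetilde N[\alpha]=\{\varepsilon\in\Pi:(\varepsilon,\alpha)\ne0\}$, i.e. $\alpha$ together with its neighbours in the Dynkin diagram. *)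

theory Defs
  imports
    "HOL-Analysis.Analysis"
    "HOL-Algebra.Bij"
    "HOL-Algebra.Generated_Groups"
    "HOL-Algebra.Multiplicative_Group"
begin

definition cartan :: "'a::euclidean_space \<Rightarrow> 'a \<Rightarrow> real" where
  "cartan \<beta> \<gamma> = 2 * (\<beta> \<bullet> \<gamma>) / (\<gamma> \<bullet> \<gamma>)"

definition refl_root :: "'a::euclidean_space \<Rightarrow> 'a \<Rightarrow> 'a" where
  "refl_root \<gamma> v = v - cartan v \<gamma> *\<^sub>R \<gamma>"

text \<open>Root systems are finite, reduced and crystallographic. They are root systems in their own
  linear span, which may be a proper subspace of the ambient Euclidean space; hence subsystems live
  in the same type, and the empty set is the root system of rank 0. Reflections act on the ambient
  space and fix the orthogonal complement of the span pointwise.\<close>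

definition root_system :: "'a::euclidean_space set \<Rightarrow> bool" where
  "root_system \<Phi> \<longleftrightarrow>
     finite \<Phi> \<and> 0 \<notin> \<Phi> \<and>
     (\<forall>\<beta>\<in>\<Phi>. \<Phi> \<inter> span {\<beta>} = {\<beta>, - \<beta>}) \<and>
     (\<forall>\<beta>\<in>\<Phi>. refl_root \<beta> ` \<Phi> = \<Phi>) \<and>
     (\<forall>\<beta>\<in>\<Phi>. \<forall>\<gamma>\<in>\<Phi>. cartan \<beta> \<gamma> \<in> \<int>)"

definition simple_system :: "'a::euclidean_space set \<Rightarrow> 'a set \<Rightarrow> bool" where
  "simple_system \<Phi> \<Delta> \<longleftrightarrow>
     \<Delta> \<subseteq> \<Phi> \<and> independent \<Delta> \<and>
     (\<forall>\<beta>\<in>\<Phi>. \<exists>k :: 'a \<Rightarrow> nat.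
        \<beta> = (\<Sum>\<delta>\<in>\<Delta>. real (k \<delta>) *\<^sub>R \<delta>) \<or>
        \<beta> = - (\<Sum>\<delta>\<in>\<Delta>. real (k \<delta>) *\<^sub>R \<delta>))"

definition generated_subsystem :: "'a::euclidean_space set \<Rightarrow> 'a set \<Rightarrow> 'a set" where
  "generated_subsystem \<Phi> S = \<Inter> {\<Psi>. root_system \<Psi> \<and> S \<subseteq> \<Psi> \<and> \<Psi> \<subseteq> \<Phi>}"

text \<open>A type is given by the Dynkin diagram with respect to some simple system. In the simply laced
  case a diagram with vertices 1, ..., n is determined by its edge relation, and its Cartan matrix
  has entries 2, -1, 0 for equal, adjacent and non-adjacent vertices.\<close>

definition simply_laced_type ::
    "(nat \<Rightarrow> nat \<Rightarrow> bool) \<Rightarrow> nat \<Rightarrow> 'a::euclidean_space set \<Rightarrow> bool" where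
  "simply_laced_type E n \<Phi> \<longleftrightarrow>
     (\<exists>\<Delta> f. simple_system \<Phi> \<Delta> \<and> bij_betw f {1..n} \<Delta> \<and>
        (\<forall>i\<in>{1..n}. \<forall>j\<in>{1..n}. cartan (f i) (f j) =
           (if i = j then 2 else if E i j \<or> E j i then - 1 else 0)))"

definition type_A :: "nat \<Rightarrow> 'a::euclidean_space set \<Rightarrow> bool" where
  "type_A n \<Phi> \<longleftrightarrow> n \<ge> 1 \<and> simply_laced_type (\<lambda>i j. j = i + 1) n \<Phi>"

text \<open>The diagram of type D is the path 1 -- 2 -- ... -- (n-1) together with the edge (n-2) -- n.
  The low-rank coincidence with type A in rank 3 is excluded.\<close>

definition type_D :: "nat \<Rightarrow> 'a::euclidean_space set \<Rightarrow> bool" where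
  "type_D n \<Phi> \<longleftrightarrow> n \<ge> 4 \<and>
     simply_laced_type (\<lambda>i j. (j = i + 1 \<and> j < n) \<or> (i + 2 = n \<and> j = n)) n \<Phi>"

text \<open>The set of neighbours of a leaf has at most one element; it is empty exactly for the one-vertex
  diagram of type A in rank 1, whose only vertex counts as a leaf.\<close>

definition dynkin_leaf :: "'a::euclidean_space set \<Rightarrow> 'a \<Rightarrow> bool" where
  "dynkin_leaf \<Delta> \<alpha> \<longleftrightarrow>
     \<alpha> \<in> \<Delta> \<and> card {\<beta>\<in>\<Delta>. \<beta> \<noteq> \<alpha> \<and> \<beta> \<bullet> \<alpha> \<noteq> 0} \<le> 1"

definition closed_nbhd :: "'a::euclidean_space set \<Rightarrow> 'a \<Rightarrow> 'a set" where
  "closed_nbhd \<Delta> \<alpha> = {\<epsilon>\<in>\<Delta>. \<epsilon> \<bullet> \<alpha> \<noteq> 0}"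

text \<open>The index \<open>X\<close> lists the simple reflections that are omitted, not those that generate.\<close>

definition weyl_omit :: "'a::euclidean_space set \<Rightarrow> 'a set \<Rightarrow> ('a \<Rightarrow> 'a) set" where
  "weyl_omit \<Delta> X = generate (BijGroup UNIV) (refl_root ` (\<Delta> - X))"

definition coxeter_elements :: "'a::euclidean_space set \<Rightarrow> ('a \<Rightarrow> 'a) set" where
  "coxeter_elements \<Phi> =
     {foldr (\<circ>) (map refl_root ds) id | ds. distinct ds \<and> simple_system \<Phi> (set ds)}"

text \<open>The order of a Coxeter element does not depend on the simple system or on the order of the
  factors.\<close>

definition coxeter_number :: "'a::euclidean_space set \<Rightarrow> nat" where
  "coxeter_number \<Phi> = (THE h. \<exists>c\<in>coxeter_elements \<Phi>. h = group.ord (BijGroup UNIV) c)"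

end

theory Submission
  imports Defs
begin

text \<open>All simple systems of a root system are conjugate, and the Coxeter elements attached to a forest
  are conjugate for all orders of the factors, so every Coxeter number can be read off one explicit
  product. In type \<open>A\<^sub>n\<close> that product cycles \<open>n + 1\<close> weights; in type \<open>D\<^sub>n\<close> it acts on the coordinate
  vectors as a negacycle of length \<open>n - 1\<close> together with a sign change, which gives \<open>2 (n - 1)\<close>. The
  orders of the parabolic subgroups come from coset transversals: \<open>|W(A\<^sub>m)| = (m + 1) |W(A\<^bsub>m-1\<^esub>)|\<close>
  and \<open>|W(D\<^sub>m)| = 2 m |W(D\<^bsub>m-1\<^esub>)|\<close>. The three kinds of leaves (an end of \<open>A\<^sub>n\<close>, the tail of
  \<open>D\<^sub>n\<close>, a fork end of \<open>D\<^sub>n\<close>) then give \<open>2 n\<close>, \<open>4 (n - 1)\<close> and \<open>n (n - 1)\<close>.\<close>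

section \<open>Groups generated by reflections\<close>

text \<open>Why the identity is to be expected: h n is the number of roots, so the left side counts
  the roots whose expansion involves \<alpha>. For a leaf in type A or D that coefficient is 1, 0 or
  -1, the roots with coefficient 1 form one orbit of W_\<alpha>, and the stabiliser of \<alpha> in
  W_\<alpha> is generated by the simple reflections fixing \<alpha>. The proof evaluates both sides
  instead. The main obstacle is the definite description of the Coxeter number: it ranges over all
  simple systems and all arrangements of the factors, so a common order has to be established before
  any value can be read off. Diagrams without cycles make this possible, because a leaf commutes
  with all factors but one. A second obstacle is the ambient space, which may be larger than the
  span of the roots: a power of a Coxeter product is the identity only if it also fixes the
  orthogonal complement. Group orders are found without listing elements, since cosets are told
  apart by the images of a single vector.\<close>

lemma cartan_add: "cartan (u + v) \<gamma> = cartan u \<gamma> + cartan v \<gamma>"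
  by (simp add: cartan_def inner_add_left add_divide_distrib)

lemma cartan_diff: "cartan (u - v) \<gamma> = cartan u \<gamma> - cartan v \<gamma>"
  by (simp add: cartan_def inner_diff_left diff_divide_distrib)

lemma cartan_minus: "cartan (- u) \<gamma> = - cartan u \<gamma>"
  by (simp add: cartan_def)

lemma cartan_scaleR: "cartan (a *\<^sub>R u) \<gamma> = a * cartan u \<gamma>"
  by (simp add: cartan_def)

lemma cartan_eq_0_iff: "\<gamma> \<noteq> 0 \<Longrightarrow> cartan v \<gamma> = 0 \<longleftrightarrow> v \<bullet> \<gamma> = 0"
  by (simp add: cartan_def)

lemma cartan_self: "\<gamma> \<noteq> 0 \<Longrightarrow> cartan \<gamma> \<gamma> = 2"
  by (simp add: cartan_def)

lemma linear_refl_root: "linear (refl_root \<gamma>)"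
  by (rule linearI) (auto simp: refl_root_def cartan_add cartan_scaleR algebra_simps)

lemma refl_root_minus: "refl_root \<gamma> (- u) = - refl_root \<gamma> u"
  using linear_refl_root by (rule linear_neg)

lemma refl_root_self: "refl_root \<gamma> \<gamma> = - \<gamma>"
  by (cases "\<gamma> = 0") (auto simp: refl_root_def cartan_self scaleR_2)

lemma refl_root_fix: "v \<bullet> \<gamma> = 0 \<Longrightarrow> refl_root \<gamma> v = v"
  by (simp add: refl_root_def cartan_def)

lemma refl_root_invol [simp]: "refl_root \<gamma> (refl_root \<gamma> v) = v"
proof -
  have "refl_root \<gamma> (refl_root \<gamma> v) = refl_root \<gamma> v - cartan v \<gamma> *\<^sub>R refl_root \<gamma> \<gamma>"
    using linear_diff[OF linear_refl_root] linear_scale[OF linear_refl_root]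
    by (metis refl_root_def)
  then show ?thesis
    by (simp add: refl_root_self) (simp add: refl_root_def)
qed

lemma refl_root_comp_invol: "refl_root \<gamma> \<circ> refl_root \<gamma> = id"
  by auto

lemma orthogonal_refl_root: "orthogonal_transformation (refl_root \<gamma>)"
  unfolding orthogonal_transformation_def
proof (intro conjI allI linear_refl_root)
  fix u v
  show "refl_root \<gamma> u \<bullet> refl_root \<gamma> v = u \<bullet> v"
    by (cases "\<gamma> = 0")
      (auto simp: refl_root_def cartan_def inner_diff_left inner_diff_right inner_commute
        field_simps)
qed

lemma bij_refl_root: "bij (refl_root \<gamma>)"
  using orthogonal_refl_root orthogonal_transformation_bij by blast

lemma orthogonal_cartan:
  "orthogonal_transformation w \<Longrightarrow> cartan (w u) (w v) = cartan u v"
  by (simp add: cartan_def orthogonal_transformation_def)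

lemma orthogonal_refl_root_image:
  assumes "orthogonal_transformation w"
  shows "refl_root (w \<gamma>) (w v) = w (refl_root \<gamma> v)"
  using assms orthogonal_transformation_linear[OF assms]
  by (simp add: refl_root_def orthogonal_cartan linear_diff linear_scale)

text \<open>Conjugation by an orthogonal map carries reflections to reflections. This is how a
  generator is pushed through a coset representative and how Coxeter products are transported
  between simple systems.\<close>

lemma refl_root_comp_orthogonal:
  assumes "orthogonal_transformation w"
  shows "refl_root (w \<gamma>) \<circ> w = w \<circ> refl_root \<gamma>"
  using orthogonal_refl_root_image[OF assms] by auto

lemma refl_root_commute:
  assumes "\<beta> \<bullet> \<gamma> = 0"
  shows "refl_root \<beta> \<circ> refl_root \<gamma> = refl_root \<gamma> \<circ> refl_root \<beta>"
  using refl_root_comp_orthogonal[OF orthogonal_refl_root, of \<beta> \<gamma>] assms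
  by (simp add: refl_root_fix inner_commute)

section \<open>Words in reflections\<close>

text \<open>Reflections are involutions, so words without inverses already form a group. Letters are
  added on the left, the side on which the coset argument multiplies by a generator.\<close>

inductive refl_word :: "'a::euclidean_space set \<Rightarrow> ('a \<Rightarrow> 'a) \<Rightarrow> bool" for S where
  id: "refl_word S id"
| refl: "s \<in> S \<Longrightarrow> refl_word S g \<Longrightarrow> refl_word S (refl_root s \<circ> g)"

definition refl_group :: "'a::euclidean_space set \<Rightarrow> ('a \<Rightarrow> 'a) set" where
  "refl_group S = Collect (refl_word S)"

lemma refl_group_id: "id \<in> refl_group S"
  by (simp add: refl_group_def refl_word.id)

lemma refl_group_refl: "s \<in> S \<Longrightarrow> g \<in> refl_group S \<Longrightarrow> refl_root s \<circ> g \<in> refl_group S"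
  by (simp add: refl_group_def refl_word.refl)

lemmas refl_group_intros = refl_group_id refl_group_refl

lemma refl_group_induct [consumes 1, case_names id refl, induct set: refl_group]:
  assumes "g \<in> refl_group S" "P id"
    and "\<And>s g. s \<in> S \<Longrightarrow> g \<in> refl_group S \<Longrightarrow> P g \<Longrightarrow> P (refl_root s \<circ> g)"
  shows "P g"
proof -
  have "refl_word S g" using assms(1) by (simp add: refl_group_def)
  then show ?thesis by induction (use assms in \<open>auto simp only: refl_group_def mem_Collect_eq\<close>)
qed

lemma refl_group_comp: "g \<in> refl_group S \<Longrightarrow> h \<in> refl_group S \<Longrightarrow> g \<circ> h \<in> refl_group S"
  by (induction rule: refl_group_induct) (auto simp: comp_assoc intro: refl_group_intros)

lemma refl_group_gen: "s \<in> S \<Longrightarrow> refl_root s \<in> refl_group S"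
  using refl_group_refl[OF _ refl_group_id] by force

lemma refl_group_orthogonal: "g \<in> refl_group S \<Longrightarrow> orthogonal_transformation g"
  by (induction rule: refl_group_induct)
    (simp_all add: id_def orthogonal_transformation_compose orthogonal_refl_root del: o_apply)

lemma refl_group_bij: "g \<in> refl_group S \<Longrightarrow> bij g"
  using refl_group_orthogonal orthogonal_transformation_bij by blast

lemma refl_group_mono: "S \<subseteq> T \<Longrightarrow> refl_group S \<subseteq> refl_group T"
proof
  fix g assume "S \<subseteq> T" "g \<in> refl_group S"
  from this(2) show "g \<in> refl_group T"
    by induction (use \<open>S \<subseteq> T\<close> refl_group_intros in blast)+
qed

lemma refl_group_fix: "g \<in> refl_group S \<Longrightarrow> (\<And>s. s \<in> S \<Longrightarrow> refl_root s x = x) \<Longrightarrow> g x = x"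
  by (induction rule: refl_group_induct) auto

section \<open>Reflection groups inside the group of all bijections\<close>

lemma BijGroup_UNIV:
  "carrier (BijGroup UNIV) = {f. bij f}" "\<one>\<^bsub>BijGroup UNIV\<^esub> = id"
  "bij f \<Longrightarrow> bij g \<Longrightarrow> f \<otimes>\<^bsub>BijGroup UNIV\<^esub> g = f \<circ> g"
  by (auto simp: BijGroup_def Bij_def compose_def)

lemma BijGroup_UNIV_pow: "bij f \<Longrightarrow> f [^]\<^bsub>BijGroup UNIV\<^esub> (n::nat) = f ^^ n"
proof (induction n)
  case 0
  then show ?case by (simp add: BijGroup_UNIV)
next
  case (Suc n)
  then have "bij (f ^^ n)" by (simp add: bij_fn)
  with Suc show ?case
    by (simp add: BijGroup_UNIV funpow_Suc_right del: funpow.simps)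
qed

lemma BijGroup_UNIV_ord_eqI:
  assumes "bij c" "\<And>d. c ^^ d = id \<longleftrightarrow> h dvd d"
  shows "group.ord (BijGroup UNIV) c = h"
  using group.ord_unique[OF group_BijGroup, of c UNIV h] assms
  by (simp add: BijGroup_UNIV BijGroup_UNIV_pow)

lemma generate_refl_root: "generate (BijGroup UNIV) (refl_root ` S) = refl_group S"
proof
  have inv: "inv\<^bsub>BijGroup UNIV\<^esub> (refl_root s) = refl_root s" for s :: 'a
    by (rule group.inv_equality[OF group_BijGroup]) (auto simp: BijGroup_UNIV bij_refl_root)
  show "generate (BijGroup UNIV) (refl_root ` S) \<subseteq> refl_group S"
  proof
    fix g assume "g \<in> generate (BijGroup UNIV) (refl_root ` S)"
    then show "g \<in> refl_group S"
    proof induction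
      case one
      then show ?case by (metis BijGroup_UNIV(2) refl_group_id)
    next
      case (incl h)
      then show ?case by (auto intro: refl_group_gen)
    next
      case (inv h)
      then show ?case by (auto simp: \<open>\<And>s. inv\<^bsub>BijGroup UNIV\<^esub> (refl_root s) = refl_root s\<close> intro: refl_group_gen)
    next
      case (eng g h)
      then show ?case by (metis BijGroup_UNIV(3) refl_group_bij refl_group_comp)
    qed
  qed
  show "refl_group S \<subseteq> generate (BijGroup UNIV) (refl_root ` S)"
  proof
    fix g assume "g \<in> refl_group S"
    then show "g \<in> generate (BijGroup UNIV) (refl_root ` S)"
    proof induction
      case id
      then show ?case using generate.one by (metis BijGroup_UNIV(2))
    next
      case (refl s g)
      have "refl_root s \<otimes>\<^bsub>BijGroup UNIV\<^esub> g \<in> generate (BijGroup UNIV) (refl_root ` S)"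
        using refl by (intro generate.eng) (auto intro: generate.incl)
      then show ?case using refl by (metis BijGroup_UNIV(3) refl_group_bij bij_refl_root)
    qed
  qed
qed

lemma weyl_omit_eq: "weyl_omit \<Delta> X = refl_group (\<Delta> - X)"
  by (simp add: weyl_omit_def generate_refl_root)

text \<open>Schreier's argument: the elements \<open>T i\<close> form a transversal of \<open>refl_group S'\<close>, the stabiliser
  of \<open>x\<close>, once each generator maps a coset \<open>T i \<circ> refl_group S'\<close> to another one.\<close>

lemma card_refl_group_transversal:
  assumes sub: "S' \<subseteq> S" and fixed: "\<And>s. s \<in> S' \<Longrightarrow> refl_root s x = x"
    and T: "\<And>i. i \<in> I \<Longrightarrow> T i \<in> refl_group S" "i0 \<in> I" "T i0 = id"
    and inj: "inj_on (\<lambda>i. T i x) I"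
    and step: "\<And>s i. s \<in> S \<Longrightarrow> i \<in> I \<Longrightarrow> \<exists>j\<in>I. \<exists>h\<in>refl_group S'. refl_root s \<circ> T i = T j \<circ> h"
  shows "card (refl_group S) = card I * card (refl_group S')"
proof -
  have "inj_on (\<lambda>(i, h). T i \<circ> h) (I \<times> refl_group S')"
  proof (rule inj_onI, clarify)
    fix i h j k
    assume *: "i \<in> I" "j \<in> I" "h \<in> refl_group S'" "k \<in> refl_group S'" "T i \<circ> h = T j \<circ> k"
    have "h x = x" "k x = x" using refl_group_fix[of _ S' x] fixed * by blast+
    with *(5) have "T i x = T j x" by (metis comp_apply)
    with inj * have "i = j" by (auto dest: inj_onD)
    moreover have "inj (T i)" using refl_group_bij T(1) * bij_is_inj by blast
    ultimately show "i = j \<and> h = k" using *(5) by (simp add: fun.inj_map_strong fun_eq_iff inj_eq)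
  qed
  moreover have "(\<lambda>(i, h). T i \<circ> h) ` (I \<times> refl_group S') = refl_group S"
  proof (intro equalityI subsetI)
    fix g assume "g \<in> (\<lambda>(i, h). T i \<circ> h) ` (I \<times> refl_group S')"
    then show "g \<in> refl_group S" using T(1) refl_group_mono[OF sub] by (auto intro!: refl_group_comp)
  next
    fix g assume "g \<in> refl_group S"
    then show "g \<in> (\<lambda>(i, h). T i \<circ> h) ` (I \<times> refl_group S')"
    proof induction
      case id
      have "id = (\<lambda>(i, h). T i \<circ> h) (i0, id)" using T by simp
      then show ?case using T(2) refl_group_id by blast
    next
      case (refl s g)
      then obtain i h where "i \<in> I" "h \<in> refl_group S'" "g = T i \<circ> h" by (auto simp only: image_iff)
      moreover obtain j k where "j \<in> I" "k \<in> refl_group S'" "refl_root s \<circ> T i = T j \<circ> k"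
        using step refl \<open>i \<in> I\<close> by blast
      ultimately have "refl_root s \<circ> g = (\<lambda>(i, h). T i \<circ> h) (j, k \<circ> h)" "k \<circ> h \<in> refl_group S'"
        by (auto simp: refl_group_comp comp_assoc[symmetric])
      with \<open>j \<in> I\<close> show ?case by blast
    qed
  qed
  ultimately have "card (I \<times> refl_group S') = card (refl_group S)"
    using card_image by fastforce
  then show ?thesis by (simp add: card_cartesian_product)
qed

section \<open>Root systems and simple systems\<close>

lemma root_system_refl:
  "root_system \<Phi> \<Longrightarrow> \<beta> \<in> \<Phi> \<Longrightarrow> \<gamma> \<in> \<Phi> \<Longrightarrow> refl_root \<beta> \<gamma> \<in> \<Phi>"
  unfolding root_system_def by blast

lemma root_system_span:
  "root_system \<Phi> \<Longrightarrow> \<beta> \<in> \<Phi> \<Longrightarrow> \<gamma> \<in> \<Phi> \<Longrightarrow> \<gamma> \<in> span {\<beta>} \<Longrightarrow> \<gamma> = \<beta> \<or> \<gamma> = - \<beta>"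
  unfolding root_system_def by blast

lemma root_system_uminus: "root_system \<Phi> \<Longrightarrow> \<beta> \<in> \<Phi> \<Longrightarrow> - \<beta> \<in> \<Phi>"
  using root_system_refl[of \<Phi> \<beta> \<beta>] by (simp add: refl_root_self)

lemma root_system_refl_group:
  assumes "g \<in> refl_group S" "root_system \<Phi>" "S \<subseteq> \<Phi>" "\<gamma> \<in> \<Phi>"
  shows "g \<gamma> \<in> \<Phi>"
  using assms(1) by induction (use assms root_system_refl in auto)

section \<open>The positive cone and positive roots\<close>

text \<open>The positive roots for \<open>\<Delta>\<close> are the roots in this cone. Coefficients
  are real rather than natural, so that inclusions of cones can be tested on generators;
  \<open>representation\<close> vanishes off \<open>\<Delta>\<close>, so the quantifier may run over
  all vectors.\<close>

definition cone_of :: "'a::euclidean_space set \<Rightarrow> 'a set" where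
  "cone_of \<Delta> = {v \<in> span \<Delta>. \<forall>\<delta>. 0 \<le> representation \<Delta> v \<delta>}"

lemma simple_system_finite: "simple_system \<Phi> \<Delta> \<Longrightarrow> finite \<Delta>"
  by (simp add: simple_system_def independent_imp_finite)

lemma representation_sum_scaleR:
  assumes "independent B" "finite B"
  shows "representation B (\<Sum>b\<in>B. c b *\<^sub>R b) = (\<lambda>b. if b \<in> B then c b else 0)"
proof -
  have "representation B (\<Sum>b\<in>B. c b *\<^sub>R b) = (\<lambda>x. \<Sum>b\<in>B. c b * (if x = b then 1 else 0))"
    using assms by (subst representation_sum)
      (auto simp: representation_scale representation_basis span_base span_scale intro!: sum.cong)
  then show ?thesis using assms by (simp add: fun_eq_iff if_distrib cong: if_cong)
qed

lemma sum_in_cone_of: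
  assumes "independent \<Delta>" "\<And>\<delta>. \<delta> \<in> \<Delta> \<Longrightarrow> 0 \<le> c \<delta>"
  shows "(\<Sum>\<delta>\<in>\<Delta>. c \<delta> *\<^sub>R \<delta>) \<in> cone_of \<Delta>"
  using assms
  by (auto simp: cone_of_def representation_sum_scaleR independent_imp_finite
      intro!: span_sum span_scale intro: span_base)

lemma root_in_cone_of:
  assumes "simple_system \<Phi> \<Delta>" "\<beta> \<in> \<Phi>"
  shows "\<beta> \<in> cone_of \<Delta> \<or> - \<beta> \<in> cone_of \<Delta>"
proof -
  obtain k :: "'a \<Rightarrow> nat" where "\<beta> = (\<Sum>\<delta>\<in>\<Delta>. real (k \<delta>) *\<^sub>R \<delta>) \<or> \<beta> = - (\<Sum>\<delta>\<in>\<Delta>. real (k \<delta>) *\<^sub>R \<delta>)"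
    using assms unfolding simple_system_def by blast
  moreover have "(\<Sum>\<delta>\<in>\<Delta>. real (k \<delta>) *\<^sub>R \<delta>) \<in> cone_of \<Delta>"
    using assms by (intro sum_in_cone_of) (auto simp: simple_system_def)
  ultimately show ?thesis by auto
qed

lemma cone_of_representation:
  assumes "v \<in> cone_of \<Delta>" "independent \<Delta>"
  shows "v = (\<Sum>\<delta>\<in>\<Delta>. representation \<Delta> v \<delta> *\<^sub>R \<delta>)"
  using assms sum_representation_eq[of \<Delta> v \<Delta>] by (auto simp: cone_of_def independent_imp_finite)

lemma cone_of_antisym:
  assumes "v \<in> cone_of \<Delta>" "- v \<in> cone_of \<Delta>" "independent \<Delta>"
  shows "v = 0"
proof -
  have "representation \<Delta> v \<delta> = 0" for \<delta>
    using assms by (simp add: cone_of_def representation_neg) (meson antisym)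
  then show ?thesis using cone_of_representation[OF assms(1,3)] by simp
qed

lemma cone_of_add: "independent \<Delta> \<Longrightarrow> u \<in> cone_of \<Delta> \<Longrightarrow> v \<in> cone_of \<Delta> \<Longrightarrow> u + v \<in> cone_of \<Delta>"
  by (auto simp: cone_of_def representation_add span_add)

lemma cone_of_scaleR: "independent \<Delta> \<Longrightarrow> v \<in> cone_of \<Delta> \<Longrightarrow> 0 \<le> c \<Longrightarrow> c *\<^sub>R v \<in> cone_of \<Delta>"
  by (auto simp: cone_of_def representation_scale span_scale)

lemma cone_of_zero: "0 \<in> cone_of \<Delta>"
  by (simp add: cone_of_def representation_zero span_zero)

lemma cone_of_sum_closed:
  "independent \<Delta> \<Longrightarrow> (\<And>i. i \<in> I \<Longrightarrow> v i \<in> cone_of \<Delta>) \<Longrightarrow> (\<Sum>i\<in>I. v i) \<in> cone_of \<Delta>"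
  by (induction I rule: infinite_finite_induct) (auto intro: cone_of_zero cone_of_add)

lemma cone_of_mono:
  assumes "independent \<Delta>" "independent \<Delta>'" "\<Delta> \<subseteq> cone_of \<Delta>'"
  shows "cone_of \<Delta> \<subseteq> cone_of \<Delta>'"
proof
  fix v assume v: "v \<in> cone_of \<Delta>"
  have "(\<Sum>\<delta>\<in>\<Delta>. representation \<Delta> v \<delta> *\<^sub>R \<delta>) \<in> cone_of \<Delta>'"
    using v assms by (intro cone_of_sum_closed cone_of_scaleR) (auto simp: cone_of_def)
  then show "v \<in> cone_of \<Delta>'" using cone_of_representation[OF v assms(1)] by simp
qed

lemma base_in_cone_of: "independent \<Delta> \<Longrightarrow> \<delta> \<in> \<Delta> \<Longrightarrow> \<delta> \<in> cone_of \<Delta>"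
  by (simp add: cone_of_def representation_basis span_base)

context
  fixes \<Phi> \<Delta> :: "'a::euclidean_space set"
  assumes root: "root_system \<Phi>" and simple: "simple_system \<Phi> \<Delta>"
begin

lemma simple_system_indep: "independent \<Delta>" and simple_system_subset: "\<Delta> \<subseteq> \<Phi>"
  using simple by (auto simp: simple_system_def)

lemma root_nonzero: "\<beta> \<in> \<Phi> \<Longrightarrow> \<beta> \<noteq> 0"
  using root by (auto simp: root_system_def)

lemma uminus_root_notin_cone: "\<beta> \<in> \<Phi> \<Longrightarrow> \<beta> \<in> cone_of \<Delta> \<Longrightarrow> - \<beta> \<notin> cone_of \<Delta>"
  using cone_of_antisym simple_system_indep root_nonzero by blast

text \<open>Reducedness leaves only \<delta> and its negative on the line through \<delta>, and the
  negative is outside the cone.\<close>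

lemma cone_of_span_singleton:
  assumes "\<beta> \<in> \<Phi>" "\<beta> \<in> cone_of \<Delta>" "\<delta> \<in> \<Delta>"
    and "\<And>\<epsilon>. \<epsilon> \<in> \<Delta> \<Longrightarrow> \<epsilon> \<noteq> \<delta> \<Longrightarrow> representation \<Delta> \<beta> \<epsilon> = 0"
  shows "\<beta> = \<delta>"
proof -
  have "\<beta> = (\<Sum>\<epsilon>\<in>\<Delta>. if \<epsilon> = \<delta> then representation \<Delta> \<beta> \<delta> *\<^sub>R \<delta> else 0)"
    by (subst cone_of_representation[OF assms(2) simple_system_indep], rule sum.cong) (auto simp: assms(4))
  then have "\<beta> = representation \<Delta> \<beta> \<delta> *\<^sub>R \<delta>"
    using simple_system_finite[OF simple] assms(3) by simp
  then have "\<beta> \<in> span {\<delta>}"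
    by (metis span_base span_scale insertI1)
  then have "\<beta> = \<delta> \<or> \<beta> = - \<delta>"
    using root_system_span[OF root] assms simple_system_subset by blast
  moreover have "\<delta> \<in> cone_of \<Delta>" using base_in_cone_of simple_system_indep assms by blast
  ultimately show ?thesis using uminus_root_notin_cone assms simple_system_subset by blast
qed

text \<open>The reflection in \<delta> changes only the coefficient of \<delta>. A positive root
  other than \<delta> has a further positive coefficient; it survives, and a root with one positive
  coefficient cannot be negative.\<close>

lemma refl_root_in_cone_of:
  assumes "\<beta> \<in> \<Phi>" "\<beta> \<in> cone_of \<Delta>" "\<delta> \<in> \<Delta>" "\<beta> \<noteq> \<delta>"
  shows "refl_root \<delta> \<beta> \<in> cone_of \<Delta>"
proof -
  obtain \<epsilon> where \<epsilon>: "\<epsilon> \<in> \<Delta>" "\<epsilon> \<noteq> \<delta>" "representation \<Delta> \<beta> \<epsilon> \<noteq> 0"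
    using cone_of_span_singleton[OF assms(1,2,3)] assms(4) by blast
  have sp: "\<beta> \<in> span \<Delta>" "\<delta> \<in> span \<Delta>" using assms by (auto simp: cone_of_def span_base)
  have "representation \<Delta> (refl_root \<delta> \<beta>) \<epsilon> = representation \<Delta> \<beta> \<epsilon>"
    using sp \<epsilon> assms simple_system_indep
    by (simp add: refl_root_def representation_diff representation_scale representation_basis
        span_scale)
  moreover have "representation \<Delta> \<beta> \<epsilon> > 0"
    using \<epsilon> assms(2) by (auto simp: cone_of_def less_le)
  moreover have "refl_root \<delta> \<beta> \<in> span \<Delta>" using sp by (simp add: refl_root_def span_diff span_scale)
  ultimately have "- refl_root \<delta> \<beta> \<notin> cone_of \<Delta>"
    by (auto simp: cone_of_def representation_neg simple_system_indep not_le intro!: exI[of _ \<epsilon>])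
  moreover have "refl_root \<delta> \<beta> \<in> \<Phi>" using root_system_refl root assms simple_system_subset by blast
  ultimately show ?thesis using root_in_cone_of simple by blast
qed

text \<open>Descent on the height. For a positive root \<gamma> the positive number \<gamma>
  \<bullet> \<gamma> is a nonnegative combination of the products \<gamma> \<bullet> \<delta>, so
  some simple \<delta> has positive product with \<gamma>, and reflecting in it lowers the
  coefficient of \<delta> alone. As there are finitely many roots, a counterexample of least height
  would exist, and this step refutes it.\<close>

lemma root_conj_simple_pos:
  assumes "\<beta> \<in> \<Phi>" "\<beta> \<in> cone_of \<Delta>"
  shows "\<exists>g\<in>refl_group \<Delta>. \<exists>\<delta>\<in>\<Delta>. \<beta> = g \<delta>"
proof (rule ccontr)
  define bad where "bad = {\<beta>\<in>\<Phi> \<inter> cone_of \<Delta>. \<not> (\<exists>g\<in>refl_group \<Delta>. \<exists>\<delta>\<in>\<Delta>. \<beta> = g \<delta>)}"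
  define ht where "ht v = (\<Sum>\<delta>\<in>\<Delta>. representation \<Delta> v \<delta>)" for v
  assume "\<not> (\<exists>g\<in>refl_group \<Delta>. \<exists>\<delta>\<in>\<Delta>. \<beta> = g \<delta>)"
  then have "bad \<noteq> {}" using assms by (auto simp: bad_def)
  moreover have "finite bad" using root by (auto simp: bad_def root_system_def)
  ultimately obtain \<gamma> where \<gamma>: "\<gamma> \<in> bad" and min: "\<And>\<eta>. \<eta> \<in> bad \<Longrightarrow> ht \<gamma> \<le> ht \<eta>"
    using ex_is_arg_min_if_finite[of bad ht] by (metis is_arg_min_linorder)
  have \<gamma>': "\<gamma> \<in> \<Phi>" "\<gamma> \<in> cone_of \<Delta>" using \<gamma> by (auto simp: bad_def)
  have "\<exists>\<delta>\<in>\<Delta>. 0 < \<gamma> \<bullet> \<delta>"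
  proof (rule ccontr)
    assume "\<not> (\<exists>\<delta>\<in>\<Delta>. 0 < \<gamma> \<bullet> \<delta>)"
    then have "(\<Sum>\<delta>\<in>\<Delta>. representation \<Delta> \<gamma> \<delta> * (\<gamma> \<bullet> \<delta>)) \<le> 0"
      using \<gamma>'(2) by (intro sum_nonpos mult_nonneg_nonpos) (auto simp: cone_of_def not_less)
    moreover have "\<gamma> \<bullet> \<gamma> = (\<Sum>\<delta>\<in>\<Delta>. representation \<Delta> \<gamma> \<delta> * (\<gamma> \<bullet> \<delta>))"
      by (subst (2) cone_of_representation[OF \<gamma>'(2) simple_system_indep]) (simp add: inner_sum_right)
    ultimately show False using root_nonzero[OF \<gamma>'(1)] by (metis inner_gt_zero_iff not_le)
  qed
  then obtain \<delta> where \<delta>: "\<delta> \<in> \<Delta>" "0 < \<gamma> \<bullet> \<delta>" by blast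
  show False
  proof (cases "\<gamma> = \<delta>")
    case True
    have "\<gamma> = id \<delta>" using True by simp
    then show False using \<gamma> \<delta> refl_group_id unfolding bad_def by blast
  next
    case False
    let ?\<eta> = "refl_root \<delta> \<gamma>"
    have c: "0 < cartan \<gamma> \<delta>"
      using \<delta> root_nonzero simple_system_subset by (auto simp: cartan_def)
    have \<eta>: "?\<eta> \<in> cone_of \<Delta>" "?\<eta> \<in> \<Phi>"
      using refl_root_in_cone_of \<gamma>' \<delta> False root_system_refl root simple_system_subset by blast+
    have rep: "representation \<Delta> ?\<eta> = (\<lambda>\<epsilon>. representation \<Delta> \<gamma> \<epsilon> - cartan \<gamma> \<delta> * (if \<epsilon> = \<delta> then 1 else 0))"
      using \<gamma>'(2) \<delta>(1) simple_system_indep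
      by (simp add: refl_root_def representation_diff representation_scale representation_basis
          span_scale cone_of_def span_base fun_eq_iff)
    have "ht ?\<eta> = ht \<gamma> - cartan \<gamma> \<delta>"
      using \<delta>(1) simple_system_finite[OF simple]
      unfolding ht_def rep by (simp add: sum_subtractf sum_distrib_left[symmetric])
    then have "?\<eta> \<notin> bad" using min c by force
    then obtain g \<epsilon> where g: "g \<in> refl_group \<Delta>" "\<epsilon> \<in> \<Delta>" "?\<eta> = g \<epsilon>" using \<eta> by (auto simp: bad_def)
    have "\<gamma> = (refl_root \<delta> \<circ> g) \<epsilon>" using g(3) by (metis comp_apply refl_root_invol)
    then show False using \<gamma> g \<delta> refl_group_refl unfolding bad_def by blast
  qed
qed

lemma root_conj_simple:
  assumes "\<beta> \<in> \<Phi>"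
  shows "\<exists>g\<in>refl_group \<Delta>. \<exists>\<delta>\<in>\<Delta>. \<beta> = g \<delta>"
proof (cases "\<beta> \<in> cone_of \<Delta>")
  case True
  then show ?thesis using root_conj_simple_pos assms by blast
next
  case False
  then have "- \<beta> \<in> cone_of \<Delta>" using root_in_cone_of simple assms by blast
  then obtain g \<delta> where g: "g \<in> refl_group \<Delta>" "\<delta> \<in> \<Delta>" "- \<beta> = g \<delta>"
    using root_conj_simple_pos root_system_uminus root assms by blast
  have "linear g" using g(1) refl_group_orthogonal orthogonal_transformation_linear by blast
  then have "\<beta> = (g \<circ> refl_root \<delta>) \<delta>" using g(3) by (simp add: refl_root_self linear_neg flip: g(3))
  then show ?thesis using g refl_group_gen refl_group_comp by blast
qed

lemma simple_system_image:
  assumes w: "orthogonal_transformation w" "w ` \<Phi> = \<Phi>"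
  shows "simple_system \<Phi> (w ` \<Delta>)"
  unfolding simple_system_def
proof (intro conjI ballI)
  have lin: "linear w" and inj: "inj w"
    using w orthogonal_transformation_linear orthogonal_transformation_inj by blast+
  show "w ` \<Delta> \<subseteq> \<Phi>" using w simple_system_subset by blast
  show "independent (w ` \<Delta>)"
    using linear_independent_injective_image[OF lin simple_system_indep] inj by (simp add: inj_on_subset)
  fix \<beta> assume "\<beta> \<in> \<Phi>"
  then obtain \<gamma> where \<gamma>: "\<gamma> \<in> \<Phi>" "\<beta> = w \<gamma>" using w by blast
  obtain k :: "'a \<Rightarrow> nat" where k:
    "\<gamma> = (\<Sum>\<delta>\<in>\<Delta>. real (k \<delta>) *\<^sub>R \<delta>) \<or> \<gamma> = - (\<Sum>\<delta>\<in>\<Delta>. real (k \<delta>) *\<^sub>R \<delta>)"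
    using simple \<gamma>(1) unfolding simple_system_def by blast
  have "w (\<Sum>\<delta>\<in>\<Delta>. real (k \<delta>) *\<^sub>R \<delta>) = (\<Sum>\<epsilon>\<in>w ` \<Delta>. real ((k \<circ> inv_into UNIV w) \<epsilon>) *\<^sub>R \<epsilon>)"
    using inj by (simp add: sum.reindex inj_on_subset linear_sum[OF lin] linear_scale[OF lin])
  then have "\<beta> = (\<Sum>\<epsilon>\<in>w ` \<Delta>. real ((k \<circ> inv_into UNIV w) \<epsilon>) *\<^sub>R \<epsilon>) \<or> \<beta> = - (\<Sum>\<epsilon>\<in>w ` \<Delta>. real ((k \<circ> inv_into UNIV w) \<epsilon>) *\<^sub>R \<epsilon>)"
    using k \<gamma>(2) linear_neg[OF lin] by metis
  then show "\<exists>k :: 'a \<Rightarrow> nat. \<beta> = (\<Sum>\<epsilon>\<in>w ` \<Delta>. real (k \<epsilon>) *\<^sub>R \<epsilon>) \<or> \<beta> = - (\<Sum>\<epsilon>\<in>w ` \<Delta>. real (k \<epsilon>) *\<^sub>R \<epsilon>)"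
    by blast
qed

text \<open>Simple roots span extreme rays of the cone: if \<delta> is a nonnegative combination of
  \<open>\<Delta>'\<close>, every member of \<open>\<Delta>'\<close> that really occurs has no
  coefficient outside \<delta>, hence equals \<delta>.\<close>

lemma simple_system_subset_cone:
  assumes simple': "simple_system \<Phi> \<Delta>'" and cone: "cone_of \<Delta>' \<subseteq> cone_of \<Delta>"
    and "\<Delta> \<subseteq> cone_of \<Delta>'"
  shows "\<Delta> \<subseteq> \<Delta>'"
proof
  fix \<delta> assume \<delta>: "\<delta> \<in> \<Delta>"
  have ind': "independent \<Delta>'" and sub': "\<Delta>' \<subseteq> \<Phi>" using simple' by (auto simp: simple_system_def)
  have \<delta>': "\<delta> \<in> cone_of \<Delta>'" using \<delta> assms by blast
  let ?c = "representation \<Delta>' \<delta>"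
  have eq: "\<delta> = (\<Sum>\<epsilon>\<in>\<Delta>'. ?c \<epsilon> *\<^sub>R \<epsilon>)" using cone_of_representation[OF \<delta>' ind'] .
  have c0: "0 \<le> ?c \<epsilon>" for \<epsilon> using \<delta>' by (simp add: cone_of_def)
  have cone': "\<epsilon> \<in> cone_of \<Delta>" if "\<epsilon> \<in> \<Delta>'" for \<epsilon>
    using base_in_cone_of[OF ind' that] cone by blast
  have "\<exists>\<epsilon>\<in>\<Delta>'. ?c \<epsilon> \<noteq> 0"
    using eq root_nonzero simple_system_subset \<delta> by (metis (no_types, lifting) scale_eq_0_iff subsetD sum.neutral)
  then obtain \<epsilon> where \<epsilon>: "\<epsilon> \<in> \<Delta>'" "?c \<epsilon> > 0" using c0 by (metis less_le)
  have "representation \<Delta> \<epsilon> \<eta> = 0" if \<eta>: "\<eta> \<in> \<Delta>" "\<eta> \<noteq> \<delta>" for \<eta>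
  proof -
    have "0 = representation \<Delta> \<delta> \<eta>" using \<delta> \<eta> simple_system_indep by (simp add: representation_basis)
    also have "\<dots> = representation \<Delta> (\<Sum>\<epsilon>\<in>\<Delta>'. ?c \<epsilon> *\<^sub>R \<epsilon>) \<eta>" using eq by simp
    also have "\<dots> = (\<Sum>\<epsilon>\<in>\<Delta>'. ?c \<epsilon> * representation \<Delta> \<epsilon> \<eta>)"
      using cone' simple_system_indep by (simp add: representation_sum representation_scale cone_of_def span_scale)
    finally have "(\<Sum>\<epsilon>\<in>\<Delta>'. ?c \<epsilon> * representation \<Delta> \<epsilon> \<eta>) = 0" by simp
    moreover have "\<forall>\<epsilon>\<in>\<Delta>'. 0 \<le> ?c \<epsilon> * representation \<Delta> \<epsilon> \<eta>"
      using c0 cone' by (auto simp: cone_of_def)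
    ultimately have "?c \<epsilon> * representation \<Delta> \<epsilon> \<eta> = 0"
      using \<epsilon>(1) simple_system_finite[OF simple'] by (simp add: sum_nonneg_eq_0_iff)
    then show ?thesis using \<epsilon>(2) by simp
  qed
  then have "\<epsilon> = \<delta>" using cone_of_span_singleton[of \<epsilon> \<delta>] \<epsilon> \<delta> cone' sub' by blast
  then show "\<delta> \<in> \<Delta>'" using \<epsilon> by simp
qed

end

section \<open>Conjugacy of simple systems\<close>

text \<open>One inclusion of cones forces the other: a member of \<open>\<Delta>'\<close> is
  positive or negative for \<open>\<Delta>\<close>, and if it were negative, its negative would lie
  in the cone of \<open>\<Delta>'\<close>. Equal cones have the same extreme rays.\<close>

lemma simple_system_unique:
  assumes "root_system \<Phi>" "simple_system \<Phi> \<Delta>" "simple_system \<Phi> \<Delta>'" "\<Delta> \<subseteq> cone_of \<Delta>'"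
  shows "\<Delta> = \<Delta>'"
proof -
  have ind: "independent \<Delta>" "independent \<Delta>'" using assms by (auto simp: simple_system_def)
  have sub: "cone_of \<Delta> \<subseteq> cone_of \<Delta>'" using cone_of_mono ind assms(4) by blast
  have "\<Delta>' \<subseteq> cone_of \<Delta>"
  proof
    fix \<epsilon> assume \<epsilon>: "\<epsilon> \<in> \<Delta>'"
    then have "\<epsilon> \<in> \<Phi>" using assms by (auto simp: simple_system_def)
    moreover have "- \<epsilon> \<notin> cone_of \<Delta>"
      using sub uminus_root_notin_cone[OF assms(1,3) \<open>\<epsilon> \<in> \<Phi>\<close>] base_in_cone_of[OF ind(2) \<epsilon>] by blast
    ultimately show "\<epsilon> \<in> cone_of \<Delta>" using root_in_cone_of assms by blast
  qed
  then have "cone_of \<Delta>' \<subseteq> cone_of \<Delta>" using cone_of_mono ind by blast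
  then show ?thesis
    using simple_system_subset_cone[OF assms(1,2,3)] simple_system_subset_cone[OF assms(1,3,2)]
      sub assms(4) \<open>\<Delta>' \<subseteq> cone_of \<Delta>\<close> by blast
qed

text \<open>Reflecting \<open>\<Delta>\<close> in a member that is negative for \<open>\<Delta>'\<close> lowers the number of roots that are
  positive for \<open>\<Delta>\<close> and negative for \<open>\<Delta>'\<close>.\<close>

lemma simple_systems_conj:
  assumes "root_system \<Phi>" "simple_system \<Phi> \<Delta>" "simple_system \<Phi> \<Delta>'"
  shows "\<exists>w. orthogonal_transformation w \<and> w ` \<Phi> = \<Phi> \<and> w ` \<Delta> = \<Delta>'"
  using assms(2)
proof (induction "card {\<beta>\<in>\<Phi>. \<beta> \<in> cone_of \<Delta> \<and> - \<beta> \<in> cone_of \<Delta>'}" arbitrary: \<Delta> rule: less_induct)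
  case less
  note root = assms(1) and simple' = assms(3)
  show ?case
  proof (cases "\<Delta> \<subseteq> cone_of \<Delta>'")
    case True
    then have "\<Delta> = \<Delta>'" using simple_system_unique root less.prems simple' by blast
    then show ?thesis by (intro exI[of _ "\<lambda>x. x"]) simp
  next
    case False
    then obtain \<delta> where \<delta>: "\<delta> \<in> \<Delta>" "\<delta> \<notin> cone_of \<Delta>'" by blast
    then have \<delta>\<Phi>: "\<delta> \<in> \<Phi>" using less.prems by (auto simp: simple_system_def)
    then have neg: "- \<delta> \<in> cone_of \<Delta>'" using \<delta> root_in_cone_of simple' by blast
    let ?s = "refl_root \<delta>" and ?P = "\<lambda>\<Delta>. {\<beta>\<in>\<Phi>. \<beta> \<in> cone_of \<Delta> \<and> - \<beta> \<in> cone_of \<Delta>'}"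
    have s: "orthogonal_transformation ?s" "?s ` \<Phi> = \<Phi>"
      using root \<delta>\<Phi> orthogonal_refl_root by (auto simp: root_system_def)
    have simple_s: "simple_system \<Phi> (?s ` \<Delta>)" using simple_system_image[OF root less.prems s] .
    have ind: "independent \<Delta>" "independent (?s ` \<Delta>)"
      using less.prems simple_s by (auto simp: simple_system_def)
    have "?P (?s ` \<Delta>) \<subseteq> ?P \<Delta> - {\<delta>}"
    proof
      fix \<beta> assume \<beta>: "\<beta> \<in> ?P (?s ` \<Delta>)"
      have "- \<delta> \<in> cone_of (?s ` \<Delta>)"
        using base_in_cone_of[OF ind(2), of "- \<delta>"] \<delta> by (force simp: refl_root_self image_iff)
      then have "\<delta> \<notin> cone_of (?s ` \<Delta>)"
        using uminus_root_notin_cone[OF root simple_s \<delta>\<Phi>] by blast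
      then have "\<beta> \<noteq> \<delta>" using \<beta> by blast
      \<comment> \<open>If \<beta> were negative for \<open>\<Delta>\<close>, then - \<beta> would
        be a positive root other than \<delta>, would stay positive under the reflection, and so
        would lie in the cone of the reflected base, which already contains \<beta>.\<close>
      have "\<beta> \<in> cone_of \<Delta>"
      proof (rule ccontr)
        assume "\<beta> \<notin> cone_of \<Delta>"
        then have 1: "- \<beta> \<in> cone_of \<Delta>" using root_in_cone_of less.prems \<beta> by blast
        have "\<beta> \<noteq> - \<delta>"
        proof
          assume "\<beta> = - \<delta>"
          then have "\<delta> \<in> cone_of \<Delta>'" using \<beta> by simp
          with \<delta> show False by blast
        qed
        then have "- \<beta> \<noteq> \<delta>" by auto
        moreover have "- \<beta> \<in> \<Phi>" using \<beta> root root_system_uminus by blast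
        ultimately have *: "?s (- \<beta>) \<in> cone_of \<Delta>"
          using refl_root_in_cone_of[OF root less.prems] 1 \<delta> by blast
        have lin: "linear ?s" using linear_refl_root .
        have "?s (?s (- \<beta>)) \<in> cone_of (?s ` \<Delta>)"
        proof -
          have "?s (\<Sum>\<epsilon>\<in>\<Delta>. representation \<Delta> (?s (- \<beta>)) \<epsilon> *\<^sub>R \<epsilon>)
            = (\<Sum>\<epsilon>\<in>\<Delta>. representation \<Delta> (?s (- \<beta>)) \<epsilon> *\<^sub>R ?s \<epsilon>)"
            by (simp add: linear_sum[OF lin] linear_scale[OF lin])
          also have "\<dots> \<in> cone_of (?s ` \<Delta>)"
            using * ind base_in_cone_of by (intro cone_of_sum_closed cone_of_scaleR) (auto simp: cone_of_def)
          finally show ?thesis using cone_of_representation[OF * ind(1)] by simp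
        qed
        then have "- \<beta> \<in> cone_of (?s ` \<Delta>)" by simp
        then show False using uminus_root_notin_cone[OF root simple_s] \<beta> by blast
      qed
      then show "\<beta> \<in> ?P \<Delta> - {\<delta>}" using \<beta> \<open>\<beta> \<noteq> \<delta>\<close> by blast
    qed
    moreover have "\<delta> \<in> ?P \<Delta>" using \<delta>\<Phi> neg base_in_cone_of ind \<delta> by blast
    moreover have "finite \<Phi>" using root by (simp add: root_system_def)
    ultimately have "card (?P (?s ` \<Delta>)) < card (?P \<Delta>)"
      by (intro psubset_card_mono) auto
    from less.hyps[OF this simple_s] obtain w where
      w: "orthogonal_transformation w" "w ` \<Phi> = \<Phi>" "w ` ?s ` \<Delta> = \<Delta>'" by blast
    have "orthogonal_transformation (w \<circ> ?s)" 
      using orthogonal_transformation_compose[OF w(1) s(1)] .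
    moreover have "(w \<circ> ?s) ` \<Phi> = \<Phi>" "(w \<circ> ?s) ` \<Delta> = \<Delta>'"
      using w s by (simp_all only: image_comp[symmetric])
    ultimately show ?thesis by blast
  qed
qed

section \<open>Subsystems spanned by simple roots\<close>

lemma root_system_Int_span:
  assumes "root_system \<Phi>"
  shows "root_system (\<Phi> \<inter> span D)"
  unfolding root_system_def
proof (intro conjI ballI)
  show "finite (\<Phi> \<inter> span D)" "0 \<notin> \<Phi> \<inter> span D" using assms by (auto simp: root_system_def)
  fix \<beta> assume \<beta>: "\<beta> \<in> \<Phi> \<inter> span D"
  have "\<Phi> \<inter> span {\<beta>} = {\<beta>, - \<beta>}" using \<beta> assms by (simp add: root_system_def)
  then show "\<Phi> \<inter> span D \<inter> span {\<beta>} = {\<beta>, - \<beta>}" using \<beta> span_neg by blast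
  have *: "refl_root \<beta> \<gamma> \<in> \<Phi> \<inter> span D" if "\<gamma> \<in> \<Phi> \<inter> span D" for \<gamma>
    using that \<beta> root_system_refl[OF assms] by (auto simp: refl_root_def span_diff span_scale)
  show "refl_root \<beta> ` (\<Phi> \<inter> span D) = \<Phi> \<inter> span D"
  proof (intro equalityI subsetI)
    fix \<gamma> assume "\<gamma> \<in> \<Phi> \<inter> span D"
    then have "refl_root \<beta> (refl_root \<beta> \<gamma>) \<in> refl_root \<beta> ` (\<Phi> \<inter> span D)" using * by blast
    then show "\<gamma> \<in> refl_root \<beta> ` (\<Phi> \<inter> span D)" by simp
  qed (use * in blast)
  fix \<gamma> assume "\<gamma> \<in> \<Phi> \<inter> span D"
  then show "cartan \<beta> \<gamma> \<in> \<int>" using \<beta> assms by (simp add: root_system_def)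
qed

text \<open>By uniqueness of coordinates, a root in the span of \<open>D\<close> has coefficients 0
  off \<open>D\<close>, so its natural-number expansion over \<open>\<Delta>\<close> restricts to
  \<open>D\<close>.\<close>

lemma simple_system_Int_span:
  assumes "simple_system \<Phi> \<Delta>" "D \<subseteq> \<Delta>"
  shows "simple_system (\<Phi> \<inter> span D) D"
  unfolding simple_system_def
proof (intro conjI ballI)
  have ind: "independent \<Delta>" and sub: "\<Delta> \<subseteq> \<Phi>" using assms by (auto simp: simple_system_def)
  show "D \<subseteq> \<Phi> \<inter> span D" using assms sub span_superset by blast
  show "independent D" using ind assms(2) independent_mono by blast
  have fin: "finite \<Delta>" using assms(1) by (rule simple_system_finite)
  fix \<beta> assume \<beta>: "\<beta> \<in> \<Phi> \<inter> span D"
  then obtain k :: "'a \<Rightarrow> nat" where k: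
    "\<beta> = (\<Sum>\<delta>\<in>\<Delta>. real (k \<delta>) *\<^sub>R \<delta>) \<or> \<beta> = - (\<Sum>\<delta>\<in>\<Delta>. real (k \<delta>) *\<^sub>R \<delta>)"
    using assms(1) unfolding simple_system_def by blast
  have "(\<Sum>\<delta>\<in>\<Delta>. real (k \<delta>) *\<^sub>R \<delta>) \<in> span D" (is "?v \<in> _") using k \<beta> span_neg by fastforce
  then have "representation \<Delta> ?v = representation D ?v"
    using ind assms(2) by (intro representation_extend)
  then have "real (k \<delta>) = 0" if "\<delta> \<in> \<Delta> - D" for \<delta>
    using that representation_sum_scaleR[OF ind fin, of "\<lambda>\<delta>. real (k \<delta>)"] representation_ne_zero
    by (metis Diff_iff)
  then have "?v = (\<Sum>\<delta>\<in>D. real (k \<delta>) *\<^sub>R \<delta>)"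
    using fin assms(2) by (intro sum.mono_neutral_right) auto
  then show "\<exists>k :: 'a \<Rightarrow> nat. \<beta> = (\<Sum>\<delta>\<in>D. real (k \<delta>) *\<^sub>R \<delta>) \<or> \<beta> = - (\<Sum>\<delta>\<in>D. real (k \<delta>) *\<^sub>R \<delta>)"
    using k by metis
qed

text \<open>The intersection with the span is a competitor, which gives one inclusion. For the
  other, each of its roots is the image of a member of \<open>D\<close> under reflections in
  \<open>D\<close>, and any subsystem containing \<open>D\<close> is closed under these.\<close>

lemma generated_subsystem_eq:
  assumes "root_system \<Phi>" "simple_system \<Phi> \<Delta>" "D \<subseteq> \<Delta>"
  shows "generated_subsystem \<Phi> D = \<Phi> \<inter> span D"
proof
  have D: "D \<subseteq> \<Phi> \<inter> span D" using simple_system_Int_span[OF assms(2,3)] by (simp add: simple_system_def)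
  then show "generated_subsystem \<Phi> D \<subseteq> \<Phi> \<inter> span D"
    unfolding generated_subsystem_def using root_system_Int_span[OF assms(1)] by blast
  show "\<Phi> \<inter> span D \<subseteq> generated_subsystem \<Phi> D"
    unfolding generated_subsystem_def
  proof (rule Inter_greatest, clarify)
    fix \<Psi> \<beta> assume \<Psi>: "root_system \<Psi>" "D \<subseteq> \<Psi>" "\<Psi> \<subseteq> \<Phi>" and "\<beta> \<in> \<Phi>" "\<beta> \<in> span D"
    then obtain g \<delta> where "g \<in> refl_group D" "\<delta> \<in> D" "\<beta> = g \<delta>"
      using root_conj_simple[OF root_system_Int_span[OF assms(1)] simple_system_Int_span[OF assms(2,3)]]
      by blast
    then show "\<beta> \<in> \<Psi>" using root_system_refl_group \<Psi> by blast
  qed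
qed

section \<open>Coxeter elements\<close>

definition cox_prod :: "'a::euclidean_space list \<Rightarrow> 'a \<Rightarrow> 'a" where
  "cox_prod ds = foldr (\<circ>) (map refl_root ds) id"

lemma cox_prod_Nil: "cox_prod [] = id"
  and cox_prod_Cons: "cox_prod (x # xs) = refl_root x \<circ> cox_prod xs"
  by (simp_all add: cox_prod_def)

lemma cox_prod_append: "cox_prod (xs @ ys) = cox_prod xs \<circ> cox_prod ys"
  by (induction xs) (simp_all only: append.simps cox_prod_Nil cox_prod_Cons id_comp comp_assoc)

lemma bij_cox_prod: "bij (cox_prod ds)"
  by (induction ds) (simp_all only: cox_prod_Nil cox_prod_Cons bij_id bij_comp bij_refl_root)

lemma linear_cox_prod: "linear (cox_prod ds)"
  by (induction ds)
    (simp_all only: cox_prod_Nil cox_prod_Cons linear_id linear_compose linear_refl_root)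

lemma cox_prod_fix: "(\<And>x. x \<in> set ds \<Longrightarrow> refl_root x v = v) \<Longrightarrow> cox_prod ds v = v"
  by (induction ds) (simp_all add: cox_prod_Nil cox_prod_Cons)

section \<open>Commutation and rotation moves on words\<close>

text \<open>The moves under which \<open>cox_prod\<close> changes at most by conjugation: exchanging
  orthogonal neighbours preserves the product, and a rotation conjugates it by the first
  reflection.\<close>

inductive cox_eq :: "'a::euclidean_space list \<Rightarrow> 'a list \<Rightarrow> bool" where
  cox_refl: "cox_eq xs xs"
| cox_swap: "x \<bullet> y = 0 \<Longrightarrow> cox_eq (us @ x # y # vs) (us @ y # x # vs)"
| cox_rot: "cox_eq (x # xs) (xs @ [x])"
| cox_sym: "cox_eq xs ys \<Longrightarrow> cox_eq ys xs"
| cox_trans: "cox_eq xs ys \<Longrightarrow> cox_eq ys zs \<Longrightarrow> cox_eq xs zs"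

lemma cox_eq_mset: "cox_eq xs ys \<Longrightarrow> mset xs = mset ys"
  by (induction rule: cox_eq.induct) auto

lemma cox_eq_conj: "cox_eq xs ys \<Longrightarrow> \<exists>w. bij w \<and> w \<circ> cox_prod xs = cox_prod ys \<circ> w"
proof (induction rule: cox_eq.induct)
  case (cox_refl xs)
  then show ?case by (intro exI[of _ id]) (simp only: bij_id id_comp comp_id simp_thms)
next
  case (cox_swap x y us vs)
  have "cox_prod (us @ x # y # vs) = cox_prod (us @ y # x # vs)"
    using refl_root_commute[OF cox_swap]
    by (simp only: cox_prod_append cox_prod_Cons) (metis comp_assoc)
  then show ?case by (intro exI[of _ id]) (simp only: bij_id id_comp comp_id simp_thms)
next
  case (cox_rot x xs)
  show ?case
    by (rule exI[of _ "refl_root x"])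
      (simp add: bij_refl_root cox_prod_append cox_prod_Cons cox_prod_Nil fun_eq_iff)
next
  case (cox_sym xs ys)
  then obtain w where w: "bij w" "w \<circ> cox_prod xs = cox_prod ys \<circ> w" by blast
  let ?v = "inv_into UNIV w"
  have v: "?v \<circ> w = id" "w \<circ> ?v = id"
    using w(1) by (simp_all add: bij_is_inj bij_is_surj flip: surj_iff)
  then have "?v \<circ> cox_prod ys = ?v \<circ> (cox_prod ys \<circ> w) \<circ> ?v" by (metis comp_assoc comp_id)
  also have "\<dots> = cox_prod xs \<circ> ?v" using v w(2) by (metis comp_assoc id_comp)
  finally show ?case using bij_imp_bij_inv[OF w(1)] by blast
next
  case (cox_trans xs ys zs)
  then obtain v w where "bij v" "v \<circ> cox_prod xs = cox_prod ys \<circ> v"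
    "bij w" "w \<circ> cox_prod ys = cox_prod zs \<circ> w" by blast
  then have "bij (w \<circ> v)" "(w \<circ> v) \<circ> cox_prod xs = cox_prod zs \<circ> (w \<circ> v)"
    by (auto intro: bij_comp) (metis comp_assoc)
  then show ?case by blast
qed

lemma conj_funpow_eq_id:
  assumes "bij w" "w \<circ> c = c' \<circ> w"
  shows "c ^^ d = id \<longleftrightarrow> c' ^^ d = id"
proof -
  have eq: "w \<circ> c ^^ d = c' ^^ d \<circ> w"
  proof (induction d)
    case (Suc d)
    have "w \<circ> c ^^ Suc d = (w \<circ> c) \<circ> c ^^ d" by (simp add: comp_assoc)
    also have "\<dots> = c' \<circ> (w \<circ> c ^^ d)" using assms(2) by (simp add: comp_assoc)
    also have "\<dots> = c' ^^ Suc d \<circ> w" unfolding Suc by (simp add: comp_assoc)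
    finally show ?case .
  qed simp
  show ?thesis
  proof
    assume "c ^^ d = id"
    then have "c' ^^ d \<circ> w = id \<circ> w" using eq by simp
    then show "c' ^^ d = id"
      using assms(1) by (metis bij_is_surj fun.map_id surj_fun_eq surj_id)
  next
    assume "c' ^^ d = id"
    then have "w ((c ^^ d) x) = w x" for x using eq by (metis comp_apply id_apply)
    then show "c ^^ d = id" using assms(1) by (auto simp: bij_is_inj inj_eq)
  qed
qed

lemma cox_eq_move:
  assumes "\<And>x. x \<in> set us \<Longrightarrow> x \<bullet> a = 0"
  shows "cox_eq (ps @ us @ a # vs) (ps @ a # us @ vs)"
  using assms
proof (induction us arbitrary: vs rule: rev_induct)
  case Nil
  then show ?case by (simp add: cox_refl)
next
  case (snoc x us)
  have "cox_eq ((ps @ us) @ x # a # vs) ((ps @ us) @ a # x # vs)"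
    using snoc.prems by (intro cox_swap) auto
  moreover have "cox_eq (ps @ us @ a # x # vs) (ps @ a # us @ x # vs)"
    using snoc by simp
  ultimately show ?case using cox_trans by auto
qed

text \<open>As the entries are distinct, the only possible neighbour \<open>b\<close> of
  \<open>a\<close> lies on at most one side of it. On the other side \<open>a\<close> commutes past
  everything, either straight to the front or to the end and then around by a rotation.\<close>

lemma cox_eq_to_front:
  assumes "distinct (us @ vs)" "\<And>x. x \<in> set (us @ vs) \<Longrightarrow> x \<noteq> b \<Longrightarrow> x \<bullet> a = 0"
  shows "cox_eq (us @ a # vs) (a # us @ vs)"
proof (cases "b \<in> set us")
  case False
  then show ?thesis using cox_eq_move[of us a "[]" vs] assms(2) by force
next
  case True
  then have "cox_eq (us @ vs @ [a]) (us @ a # vs)"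
    using cox_eq_move[of vs a us "[]"] assms by fastforce
  then show ?thesis using cox_rot[of a "us @ vs"] cox_sym cox_trans by (metis append.assoc)
qed

text \<open>A rotation of \<open>xs\<close> lifts to \<open>a # xs\<close>: an element orthogonal to \<open>a\<close> commutes past \<open>a\<close> before it
  is rotated, and if the rotated element is the neighbour \<open>b\<close>, then \<open>a\<close> commutes past all others.\<close>

lemma cox_eq_Cons:
  assumes "cox_eq xs ys" "distinct xs" "\<And>x. x \<in> set xs \<Longrightarrow> x \<noteq> b \<Longrightarrow> x \<bullet> a = 0"
  shows "cox_eq (a # xs) (a # ys)"
  using assms
proof (induction rule: cox_eq.induct)
  case (cox_refl xs)
  then show ?case by (simp add: cox_eq.cox_refl)
next
  case (cox_swap x y us vs)
  then show ?case using cox_eq.cox_swap[of x y "a # us" vs] by simp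
next
  case (cox_rot c w)
  show ?case
  proof (cases "c = b")
    case False
    then have "c \<bullet> a = 0" using cox_rot by simp
    then have "cox_eq (a # c # w) (c # a # w)"
      using cox_eq.cox_swap[of a c "[]" w] by (simp add: inner_commute)
    then show ?thesis using cox_eq.cox_rot[of c "a # w"] cox_trans by fastforce
  next
    case True
    have "cox_eq ([c] @ w @ a # []) ([c] @ a # w @ [])"
      using True cox_rot by (intro cox_eq_move) auto
    then have "cox_eq (a # c # w) (c # a # w)"
      using cox_eq.cox_rot[of a "c # w"] cox_trans by fastforce
    then show ?thesis using cox_eq.cox_rot[of c "a # w"] cox_trans by fastforce
  qed
next
  case (cox_sym xs ys)
  have "mset xs = mset ys" using cox_eq_mset cox_sym by blast
  then have "distinct xs" "set xs = set ys"
    using cox_sym.prems by (metis distinct_count_atmost_1 set_mset_mset)+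
  then show ?case using cox_sym cox_eq.cox_sym by blast
next
  case (cox_trans xs ys zs)
  have "mset xs = mset ys" using cox_eq_mset cox_trans by blast
  then have "distinct ys" "set xs = set ys"
    using cox_trans.prems by (metis distinct_count_atmost_1 set_mset_mset)+
  then show ?case using cox_trans cox_eq.cox_trans by blast
qed

text \<open>The list is an order in which leaves can be removed one after another. The witness
  \<open>b\<close> need not occur in the list, which covers a head without neighbours.\<close>

fun forest :: "'a::euclidean_space list \<Rightarrow> bool" where
  "forest [] \<longleftrightarrow> True"
| "forest (a # vs) \<longleftrightarrow> (\<exists>b. \<forall>x\<in>set vs. x \<noteq> b \<longrightarrow> x \<bullet> a = 0) \<and> forest vs"

text \<open>The leaf \<open>a\<close> is brought to the front, and the rearrangement of the
  remaining entries given by induction lifts past it by \<open>cox_eq_Cons\<close>.\<close>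

lemma forest_cox_eq:
  assumes "forest vs" "distinct vs" "mset ds = mset vs"
  shows "cox_eq ds vs"
  using assms
proof (induction vs arbitrary: ds)
  case Nil
  then show ?case by (simp add: cox_refl)
next
  case (Cons a vs)
  have "a \<in> set ds" using Cons.prems(3) by (metis list.set_intros(1) set_mset_mset)
  then obtain us ws where ds: "ds = us @ a # ws" by (meson split_list)
  have m: "mset (us @ ws) = mset vs" using Cons.prems(3) by (simp add: ds)
  then have d: "distinct (us @ ws)" "set (us @ ws) = set vs"
    using Cons.prems(2) by (metis distinct.simps(2) distinct_count_atmost_1 set_mset_mset)+
  obtain b where b: "\<And>x. x \<in> set vs \<Longrightarrow> x \<noteq> b \<Longrightarrow> x \<bullet> a = 0" using Cons.prems(1) by auto
  have "cox_eq ds (a # us @ ws)" unfolding ds using d b by (intro cox_eq_to_front) auto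
  moreover have "cox_eq (us @ ws) vs" using Cons m by auto
  then have "cox_eq (a # us @ ws) (a # vs)" using d b by (intro cox_eq_Cons) auto
  ultimately show ?case by (rule cox_trans)
qed

text \<open>\<open>THE\<close> yields a value only if all Coxeter elements have the same order. An
  orthogonal map pulls an arbitrary one back to a product over \<open>set vs\<close>; the forest
  order \<open>vs\<close> makes all arrangements of that set equivalent, and \<open>es\<close> is
  the arrangement whose powers are easy to compute.\<close>

lemma coxeter_number_eqI:
  assumes root: "root_system \<Phi>" and simple: "simple_system \<Phi> (set vs)"
    and vs: "distinct vs" "forest vs" and es: "mset es = mset vs"
    and ord: "\<And>d. cox_prod es ^^ d = id \<longleftrightarrow> h dvd d"
  shows "coxeter_number \<Phi> = h"
proof -
  have ord_c: "group.ord (BijGroup UNIV) c = h" if "c \<in> coxeter_elements \<Phi>" for c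
  proof -
    obtain ds where ds: "c = cox_prod ds" "distinct ds" "simple_system \<Phi> (set ds)"
      using \<open>c \<in> coxeter_elements \<Phi>\<close> unfolding coxeter_elements_def cox_prod_def by blast
    obtain w where w: "orthogonal_transformation w" "w ` set vs = set ds"
      using simple_systems_conj[OF root simple ds(3)] by blast
    let ?v = "inv_into UNIV w" 
    have bij: "bij w" using w(1) by (rule orthogonal_transformation_bij)
    define ds' where "ds' = map ?v ds"
    have ds': "ds = map w ds'"
      using bij by (simp add: ds'_def bij_is_surj surj_f_inv_f map_idI)
    have "distinct ds'" "set ds' = set vs"
      using ds(2) w(2) bij by (auto simp: ds' distinct_map inj_image_eq_iff bij_is_inj)
    then have "mset ds' = mset es"
      using vs(1) es by (metis set_eq_iff_mset_eq_distinct)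
    then have "cox_eq ds' es"
      using forest_cox_eq[OF vs(2,1)] es cox_sym cox_trans by metis
    then obtain u where u: "bij u" "u \<circ> cox_prod ds' = cox_prod es \<circ> u"
      using cox_eq_conj by blast
    have "w \<circ> cox_prod ds' = c \<circ> w" unfolding ds(1) ds'
    proof (induction ds')
      case Nil
      then show ?case by (simp only: list.map cox_prod_Nil id_comp comp_id)
    next
      case (Cons x xs)
      then show ?case using refl_root_comp_orthogonal[OF w(1), of x]
        by (simp only: list.map cox_prod_Cons) (metis comp_assoc)
    qed
    then have "c ^^ d = id \<longleftrightarrow> h dvd d" for d
      using conj_funpow_eq_id[OF bij] conj_funpow_eq_id[OF u] ord by metis
    then show ?thesis
      using BijGroup_UNIV_ord_eqI bij_cox_prod ds(1) by blast
  qed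
  have "cox_prod vs \<in> coxeter_elements \<Phi>"
    using vs(1) simple by (auto simp: coxeter_elements_def cox_prod_def)
  then show ?thesis
    unfolding coxeter_number_def using ord_c by (intro the_equality) blast+
qed

section \<open>Orders of explicit products\<close>

lemma linear_eq_idI:
  assumes "linear g" "\<And>v. v \<in> V \<Longrightarrow> g v = v"
    and "\<And>z. (\<And>v. v \<in> V \<Longrightarrow> z \<bullet> v = 0) \<Longrightarrow> g z = (z::'a::euclidean_space)"
  shows "g = id"
proof
  fix x
  obtain y z where yz: "y \<in> span V" "\<And>w. w \<in> span V \<Longrightarrow> orthogonal z w" "x = y + z"
    using orthogonal_subspace_decomp_exists by blast
  have "g y = y"
    using yz(1) assms(1,2) linear_eq_on_span[of g "\<lambda>v. v" V y] linear_id
    by (auto simp: id_def)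
  moreover have "g z = z"
    using yz(2) by (intro assms(3)) (auto simp: orthogonal_def span_base)
  ultimately show "g x = id x" using yz(3) linear_add[OF assms(1)] by simp
qed

lemma upt_split: "i \<le> j \<Longrightarrow> j < k \<Longrightarrow> [i..<k] = [i..<j] @ j # [Suc j..<k]"
  by (metis le_add_diff_inverse less_imp_le_nat upt_add_eq_append upt_conv_Cons)

lemma funpow_cycle:
  fixes p :: "nat \<Rightarrow> 'b"
  assumes "\<And>k. k < N \<Longrightarrow> c (p k) = p (Suc k mod N)" "k < N"
  shows "(c ^^ d) (p k) = p ((k + d) mod N)"
proof (induction d)
  case (Suc d)
  then show ?case using assms by (simp add: mod_Suc_eq)
qed (use assms in simp)

text \<open>The cycle \<open>p\<close> bounds the order from below. For the upper bound the power is
  the identity on the span of \<open>V\<close> and on its orthogonal complement, where every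
  reflection is trivial. \<open>V\<close> is separate from \<open>p\<close> because in type D the
  long cycle misses one coordinate vector.\<close>

lemma cox_prod_order:
  fixes p :: "nat \<Rightarrow> 'a::euclidean_space"
  assumes N: "0 < N" and cycle: "\<And>k. k < N \<Longrightarrow> cox_prod ds (p k) = p (Suc k mod N)"
    and inj: "inj_on p {..<N}" and span: "set ds \<subseteq> span V"
    and V: "\<And>v. v \<in> V \<Longrightarrow> (cox_prod ds ^^ N) v = v"
  shows "cox_prod ds ^^ d = id \<longleftrightarrow> N dvd d"
proof
  assume "cox_prod ds ^^ d = id"
  then have "p ((0 + d) mod N) = p 0" using funpow_cycle[of N "cox_prod ds" p 0 d] cycle N by simp
  then have "d mod N = 0" using inj N by (auto dest: inj_onD)
  then show "N dvd d" by blast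
next
  have lin: "linear (cox_prod ds ^^ n)" for n
    by (induction n) (simp_all only: funpow.simps linear_id linear_compose linear_cox_prod)
  have "cox_prod ds ^^ N = id"
  proof (rule linear_eq_idI[OF lin V])
    fix z assume z: "\<And>v. v \<in> V \<Longrightarrow> z \<bullet> v = 0"
    have "z \<bullet> x = 0" if "x \<in> set ds" for x
      using span that z orthogonal_to_span[of x V z] by (auto simp: orthogonal_def)
    then have "cox_prod ds z = z" by (intro cox_prod_fix refl_root_fix)
    then show "(cox_prod ds ^^ N) z = z" by (induction N) auto
  qed
  moreover assume "N dvd d"
  ultimately show "cox_prod ds ^^ d = id" by (auto elim!: dvdE simp: funpow_mult[symmetric])
qed

text \<open>Supplies vectors with prescribed products with the simple roots, such as a fundamental
  weight.\<close>

lemma independent_dual: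
  assumes "independent (B :: 'a::euclidean_space set)"
  shows "\<exists>u. \<forall>b\<in>B. u \<bullet> b = \<phi> b"
proof -
  obtain g :: "'a \<Rightarrow> real" where g: "linear g" "\<forall>b\<in>B. g b = \<phi> b"
    using linear_independent_extend[OF assms] by blast
  have "adjoint g 1 \<bullet> b = g b" for b
    using adjoint_works[OF g(1), of b 1] by (simp add: inner_commute)
  then show ?thesis using g(2) by metis
qed

section \<open>Numbered Dynkin diagrams\<close>

definition dynkin_enum :: "(nat \<Rightarrow> nat \<Rightarrow> bool) \<Rightarrow> nat \<Rightarrow> (nat \<Rightarrow> 'a::euclidean_space) \<Rightarrow> bool" where
  "dynkin_enum E m f \<longleftrightarrow> (\<forall>i\<in>{1..m}. \<forall>j\<in>{1..m}. cartan (f i) (f j) =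
     (if i = j then 2 else if E i j \<or> E j i then - 1 else 0))"

definition edge_A :: "nat \<Rightarrow> nat \<Rightarrow> bool" where
  "edge_A i j \<longleftrightarrow> j = i + 1"

definition edge_D :: "nat \<Rightarrow> nat \<Rightarrow> nat \<Rightarrow> bool" where
  "edge_D n i j \<longleftrightarrow> (j = i + 1 \<and> j < n) \<or> (i + 2 = n \<and> j = n)"

lemma dynkin_enum_cartan:
  "dynkin_enum E m f \<Longrightarrow> i \<in> {1..m} \<Longrightarrow> j \<in> {1..m} \<Longrightarrow>
    cartan (f i) (f j) = (if i = j then 2 else if E i j \<or> E j i then - 1 else 0)"
  by (simp add: dynkin_enum_def)

lemma dynkin_enum_nonzero:
  assumes "dynkin_enum E m f" "i \<in> {1..m}"
  shows "f i \<noteq> 0"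
  using dynkin_enum_cartan[OF assms(1,2,2)] by (auto simp: cartan_def)

lemma dynkin_enum_inj: "dynkin_enum E m f \<Longrightarrow> inj_on f {1..m}"
proof (rule inj_onI, rule ccontr)
  fix i j assume *: "dynkin_enum E m f" "i \<in> {1..m}" "j \<in> {1..m}" "f i = f j" "i \<noteq> j"
  then show False
    using dynkin_enum_cartan[OF *(1,2,3)] dynkin_enum_cartan[OF *(1,3,3)] by (auto split: if_splits)
qed

lemma dynkin_enum_inner:
  assumes "dynkin_enum E m f" "i \<in> {1..m}" "j \<in> {1..m}"
  shows "f i \<bullet> f j = 0 \<longleftrightarrow> i \<noteq> j \<and> \<not> E i j \<and> \<not> E j i"
  using dynkin_enum_cartan[OF assms] cartan_eq_0_iff[OF dynkin_enum_nonzero[OF assms(1,3)], of "f i"]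
  by (auto split: if_splits)

text \<open>Every vertex has at most one neighbour of smaller index, so removing vertices from the
  largest index downwards always removes a leaf; hence the reversal.\<close>

lemma dynkin_enum_forest:
  assumes f: "dynkin_enum E m f"
    and E: "\<And>k. k \<in> {1..m} \<Longrightarrow> \<exists>b. \<forall>i\<in>{1..<k}. E i k \<or> E k i \<longrightarrow> i = b"
    and "k \<le> m"
  shows "forest (rev (map f [1..<Suc k]))"
  using \<open>k \<le> m\<close>
proof (induction k)
  case 0
  then show ?case by simp
next
  case (Suc k)
  obtain b where b: "\<forall>i\<in>{1..<Suc k}. E i (Suc k) \<or> E (Suc k) i \<longrightarrow> i = b" using E[of "Suc k"] Suc by auto
  have "\<forall>x\<in>set (rev (map f [1..<Suc k])). x \<noteq> f b \<longrightarrow> x \<bullet> f (Suc k) = 0"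
  proof (intro ballI impI)
    fix x assume "x \<in> set (rev (map f [1..<Suc k]))" "x \<noteq> f b"
    then obtain i where i: "i \<in> {1..<Suc k}" "x = f i"
      by (simp only: set_rev set_map set_upt) blast
    then have "i \<noteq> b" using \<open>x \<noteq> f b\<close> by blast
    then show "x \<bullet> f (Suc k) = 0"
      using i b Suc.prems dynkin_enum_inner[OF f, of i "Suc k"] by auto
  qed
  moreover have "rev (map f [1..<Suc (Suc k)]) = f (Suc k) # rev (map f [1..<Suc k])" by simp
  ultimately show ?case using Suc by auto
qed

lemma coxeter_number_enum:
  assumes "root_system \<Phi>" "simple_system \<Phi> (f ` {1..m})" "dynkin_enum E m f"
    and "\<And>k. k \<in> {1..m} \<Longrightarrow> \<exists>b. \<forall>i\<in>{1..<k}. E i k \<or> E k i \<longrightarrow> i = b"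
    and "\<And>d. cox_prod (map f [1..<Suc m]) ^^ d = id \<longleftrightarrow> h dvd d"
  shows "coxeter_number \<Phi> = h"
proof (rule coxeter_number_eqI[OF assms(1)])
  have s: "set (rev (map f [1..<Suc m])) = f ` {1..m}" by (auto simp: less_Suc_eq_le)
  then show "simple_system \<Phi> (set (rev (map f [1..<Suc m])))" using assms(2) by simp
  show "distinct (rev (map f [1..<Suc m]))"
    using dynkin_enum_inj[OF assms(3)] 
    by (simp add: distinct_map del: upt_Suc) (metis atLeastLessThanSuc_atLeastAtMost)
  show "forest (rev (map f [1..<Suc m]))" using dynkin_enum_forest assms by blast
  show "mset (map f [1..<Suc m]) = mset (rev (map f [1..<Suc m]))" by simp
qed (use assms in blast)

section \<open>Type A\<close>

locale enum_A =
  fixes f :: "nat \<Rightarrow> 'a::euclidean_space" and m :: nat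
  assumes enum: "dynkin_enum edge_A m f" and indep: "independent (f ` {1..m})"
begin

text \<open>Up to a component orthogonal to the roots, these are the weights of the standard
  representation: the chosen vector pairs like the first fundamental weight, and successive simple
  roots are subtracted. Then \<open>f i\<close> is \<open>u (i - 1) - u i\<close>, and its
  reflection is a transposition of these two.\<close>

definition u :: "nat \<Rightarrow> 'a" where
  "u j = (SOME v. \<forall>i\<in>{1..m}. cartan v (f i) = (if i = 1 then 1 else 0)) - (\<Sum>k=1..j. f k)"

lemma u_Suc: "u (Suc j) = u j - f (Suc j)"
  by (simp add: u_def)

lemma cartan_u:
  assumes "i \<in> {1..m}" "j \<le> m"
  shows "cartan (u j) (f i) = (if i = Suc j then 1 else if i = j then - 1 else 0)"
  using assms(2)
proof (induction j)
  case 0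
  obtain v where v: "\<forall>b\<in>f ` {1..m}. v \<bullet> b = (if b = f 1 then b \<bullet> b / 2 else 0)"
    using independent_dual[OF indep, of "\<lambda>b. if b = f 1 then b \<bullet> b / 2 else 0"] by blast
  have "\<forall>i\<in>{1..m}. cartan v (f i) = (if i = 1 then 1 else 0)"
  proof
    fix i assume i: "i \<in> {1..m}"
    then have "1 \<in> {1..m}" by auto
    then have "f i = f 1 \<longleftrightarrow> i = 1" using dynkin_enum_inj[OF enum] i by (auto dest: inj_onD)
    then show "cartan v (f i) = (if i = 1 then 1 else 0)"
      using v i dynkin_enum_nonzero[OF enum i] by (auto simp: cartan_def)
  qed
  from someI[of "\<lambda>v. \<forall>i\<in>{1..m}. cartan v (f i) = (if i = 1 then 1 else 0)", OF this]
  show ?case using assms(1) by (simp add: u_def)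
next
  case (Suc j)
  have "cartan (f (Suc j)) (f i) = (if i = Suc j then 2 else if i = j \<or> i = Suc (Suc j) then - 1 else 0)"
    using dynkin_enum_cartan[OF enum, of "Suc j" i] assms(1) Suc.prems by (auto simp: edge_A_def)
  then show ?case using Suc by (auto simp: u_Suc cartan_diff)
qed

lemma refl_u:
  assumes "i \<in> {1..m}" "j \<le> m"
  shows "refl_root (f i) (u j) = (if i = Suc j then u i else if i = j then u (i - 1) else u j)"
  using cartan_u[OF assms] assms u_Suc[of "i - 1"] by (auto simp: refl_root_def u_Suc)

lemma u_inj: "inj_on u {..m}"
proof -
  have "u i \<noteq> u j" if "i < j" "j \<le> m" for i j
    using cartan_u[of "Suc i" i] cartan_u[of "Suc i" j] that by (auto split: if_splits)
  then show ?thesis by (intro inj_onI) (metis atMost_iff linorder_less_linear)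
qed

lemma cox_prod_u: "j \<le> m \<Longrightarrow> cox_prod (map f [1..<Suc j]) (u j) = u 0"
proof (induction j)
  case 0
  then show ?case by (simp add: cox_prod_Nil)
next
  case (Suc j)
  have "[1..<Suc (Suc j)] = [1..<Suc j] @ [Suc j]" by simp
  then show ?case using Suc refl_u[of "Suc j" "Suc j"]
    by (simp add: cox_prod_append cox_prod_Cons cox_prod_Nil del: upt_Suc)
qed

text \<open>The rightmost factor acts first. Only \<open>f (Suc j)\<close> moves \<open>u j\<close>,
  and the factors that act after it have smaller index and fix \<open>u (Suc j)\<close>.\<close>

lemma cox_prod_u_Suc:
  assumes "j < m"
  shows "cox_prod (map f [1..<Suc m]) (u j) = u (Suc j)"
proof -
  have "[1..<Suc m] = [1..<Suc j] @ Suc j # [Suc (Suc j)..<Suc m]"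
    using assms by (intro upt_split) auto
  moreover have "cox_prod (map f [Suc (Suc j)..<Suc m]) (u j) = u j"
    using assms refl_u by (intro cox_prod_fix) auto
  moreover have "cox_prod (map f [1..<Suc j]) (u (Suc j)) = u (Suc j)"
    using assms refl_u by (intro cox_prod_fix) auto
  ultimately show ?thesis using refl_u[of "Suc j" j] assms
    by (simp add: cox_prod_append cox_prod_Cons del: upt_Suc)
qed

lemma cox_order: "cox_prod (map f [1..<Suc m]) ^^ d = id \<longleftrightarrow> m + 1 dvd d"
proof (rule cox_prod_order[where p = u and V = "u ` {..m}"])
  show cyc: "cox_prod (map f [1..<Suc m]) (u k) = u (Suc k mod (m + 1))" if "k < m + 1" for k
  proof (cases "k = m")
    case True
    then show ?thesis using cox_prod_u[of m] by simp
  next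
    case False
    then show ?thesis using cox_prod_u_Suc[of k] that by simp
  qed
  show "inj_on u {..<m + 1}" using u_inj by (simp add: lessThan_Suc_atMost)
  show "set (map f [1..<Suc m]) \<subseteq> span (u ` {..m})"
  proof
    fix x assume "x \<in> set (map f [1..<Suc m])"
    then obtain i where i: "x = f i" "i \<in> {1..m}" by auto
    then have "x = u (i - 1) - u i" using u_Suc[of "i - 1"] by simp
    moreover have "u (i - 1) \<in> span (u ` {..m})" "u i \<in> span (u ` {..m})"
      using i by (auto intro!: span_base)
    ultimately show "x \<in> span (u ` {..m})" by (simp add: span_diff)
  qed
  show "(cox_prod (map f [1..<Suc m]) ^^ (m + 1)) v = v" if v: "v \<in> u ` {..m}" for v
  proof -
    obtain k where k: "v = u k" "k < m + 1"
      using v by (auto simp: less_Suc_eq_le)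
    show ?thesis
      using funpow_cycle[of "m + 1" "cox_prod (map f [1..<Suc m])" u k "m + 1"] cyc k
      by (simp only: mod_add_self2 mod_less)
  qed
qed simp

lemma coxeter_number_A:
  assumes "root_system \<Phi>" "simple_system \<Phi> (f ` {1..m})"
  shows "coxeter_number \<Phi> = m + 1"
proof (rule coxeter_number_enum[OF assms enum _ cox_order])
  fix k
  show "\<exists>b. \<forall>i\<in>{1..<k}. edge_A i k \<or> edge_A k i \<longrightarrow> i = b"
    by (intro exI[of _ "k - 1"]) (auto simp: edge_A_def)
qed

section \<open>Cosets in type A\<close>

text \<open>\<open>T k\<close> is s_k ... s_1. It carries \<open>u 0\<close> to \<open>u k\<close>
  and thus represents one coset of the group generated by \<open>f 2\<close>, ...,
  \<open>f m\<close>, which fixes \<open>u 0\<close>.\<close>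

definition T :: "nat \<Rightarrow> 'a \<Rightarrow> 'a" where
  "T k = cox_prod (rev (map f [1..<Suc k]))"

lemma T_0: "T 0 = id" and T_Suc: "T (Suc k) = refl_root (f (Suc k)) \<circ> T k"
  by (simp_all add: T_def cox_prod_Nil cox_prod_Cons)

lemma T_refl_group: "k \<le> m \<Longrightarrow> T k \<in> refl_group (f ` {1..m})"
proof (induction k)
  case 0
  show ?case unfolding T_0 by (rule refl_group_id)
next
  case (Suc k)
  then show ?case unfolding T_Suc by (intro refl_group_refl) auto
qed

lemma T_u: "k \<le> m \<Longrightarrow> i \<le> m \<Longrightarrow> T k (u i) = (if i = 0 then u k else if i \<le> k then u (i - 1) else u i)"
proof (induction k)
  case 0
  then show ?case by (simp add: T_0)
next
  case (Suc k)
  then show ?case using refl_u[of "Suc k"] by (auto simp: T_Suc)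
qed

lemma T_f:
  assumes "k \<le> m" "j \<in> {1..m}"
  shows "j < k \<Longrightarrow> T k (f (Suc j)) = f j" and "Suc k < j \<Longrightarrow> T k (f j) = f j"
proof -
  have lin: "linear (T k)" unfolding T_def by (rule linear_cox_prod)
  have f: "f i = u (i - 1) - u i" if "1 \<le> i" for i using u_Suc[of "i - 1"] that by simp
  show "j < k \<Longrightarrow> T k (f (Suc j)) = f j" "Suc k < j \<Longrightarrow> T k (f j) = f j"
    using assms by (auto simp: f linear_diff[OF lin] T_u)
qed

text \<open>Multiplying \<open>T k\<close> by s_j on the left lengthens it for j = k + 1 and
  shortens it for j = k. Otherwise the coset is kept: s_j passes through \<open>T k\<close> and
  becomes s_(j+1) for j < k and s_j for j > k + 1.\<close>

lemma card_refl_group_step: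
  assumes "1 \<le> m"
  shows "card (refl_group (f ` {1..m})) = (m + 1) * card (refl_group (f ` {2..m}))"
proof -
  have "card (refl_group (f ` {1..m})) = card {..m} * card (refl_group (f ` {2..m}))"
  proof (rule card_refl_group_transversal[where x = "u 0" and T = T and ?i0.0 = 0])
    show "f ` {2..m} \<subseteq> f ` {1..m}" by auto
    show "refl_root s (u 0) = u 0" if "s \<in> f ` {2..m}" for s
      using that refl_u by auto
    show "inj_on (\<lambda>i. T i (u 0)) {..m}"
      using u_inj by (simp add: inj_on_def T_u)
  next
    fix s k assume "s \<in> f ` {1..m}" "k \<in> {..m}"
    then obtain j where j: "s = f j" "j \<in> {1..m}" and k: "k \<le> m" by auto
    have orth: "orthogonal_transformation (T k)" using T_refl_group[OF k] refl_group_orthogonal by blast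
    consider "j = Suc k" | "j = k" | "j < k" | "Suc k < j" by linarith
    then show "\<exists>i\<in>{..m}. \<exists>h\<in>refl_group (f ` {2..m}). refl_root s \<circ> T k = T i \<circ> h"
    proof cases
      case 1
      then have "refl_root s \<circ> T k = T j \<circ> id" using j by (simp only: T_Suc comp_id)
      then show ?thesis using refl_group_id j by (metis atMost_iff atLeastAtMost_iff)
    next
      case 2
      then obtain i where i: "k = Suc i" using j by (cases k) auto
      have "refl_root s \<circ> T k = T i \<circ> id"
        using j 2 unfolding i T_Suc by (simp only: comp_assoc[symmetric] refl_root_comp_invol id_comp comp_id)
      moreover have "i \<in> {..m}" using i k by simp
      ultimately show ?thesis using refl_group_id by blast
    next
      case 3
      then have "refl_root s \<circ> T k = T k \<circ> refl_root (f (Suc j))"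
        using refl_root_comp_orthogonal[OF orth, of "f (Suc j)"] T_f(1)[OF k j(2)] j by simp
      moreover have "refl_root (f (Suc j)) \<in> refl_group (f ` {2..m})"
        using 3 j k by (intro refl_group_gen) auto
      ultimately show ?thesis using k by blast
    next
      case 4
      then have "refl_root s \<circ> T k = T k \<circ> refl_root (f j)"
        using refl_root_comp_orthogonal[OF orth, of "f j"] T_f(2)[OF k j(2)] j by simp
      moreover have "refl_root (f j) \<in> refl_group (f ` {2..m})"
        using 4 j by (intro refl_group_gen) auto
      ultimately show ?thesis using k by blast
    qed
  next
    show "T k \<in> refl_group (f ` {1..m})" if "k \<in> {..m}" for k using that T_refl_group by blast
  qed (simp_all add: T_0)
  then show ?thesis by simp
qed

end

lemma refl_group_empty: "refl_group ({} :: 'a::euclidean_space set) = {id}"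
proof
  show "refl_group ({} :: 'a set) \<subseteq> {id}"
  proof
    fix g :: "'a \<Rightarrow> 'a" assume "g \<in> refl_group {}"
    then show "g \<in> {id}" by induction blast+
  qed
qed (use refl_group_id in blast)

lemma card_refl_group_A:
  assumes "dynkin_enum edge_A m f" "independent (f ` {1..m})"
  shows "card (refl_group (f ` {1..m})) = fact (m + 1)"
  using assms
proof (induction m arbitrary: f)
  case 0
  then show ?case by (simp add: refl_group_empty)
next
  case (Suc m)
  interpret enum_A f "Suc m" using Suc.prems by unfold_locales
  have im: "f ` {2..Suc m} = (\<lambda>i. f (Suc i)) ` {1..m}"
    by (simp only: image_image[of f Suc, symmetric] image_Suc_atLeastAtMost) (simp add: numeral_2_eq_2)
  have "card (refl_group ((\<lambda>i. f (Suc i)) ` {1..m})) = fact (m + 1)"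
  proof (rule Suc.IH)
    show "dynkin_enum edge_A m (\<lambda>i. f (Suc i))"
      using Suc.prems(1) by (simp add: dynkin_enum_def edge_A_def)
    show "independent ((\<lambda>i. f (Suc i)) ` {1..m})"
      using Suc.prems(2) unfolding im[symmetric] by (rule independent_mono) auto
  qed
  then show ?case using card_refl_group_step unfolding im by simp
qed

section \<open>Type D\<close>

locale enum_D =
  fixes f :: "nat \<Rightarrow> 'a::euclidean_space" and m :: nat
  assumes enum: "dynkin_enum (edge_D m) m f" and m3: "3 \<le> m"
begin

text \<open>The usual coordinate vectors, obtained by solving \<open>f j = e j - e (Suc j)\<close>
  for j < m and \<open>f m = e (m - 1) + e m\<close>; the last two equations give \<open>e m\<close>
  as half the difference of the fork ends. They lie in the span of the roots, so no dual vector has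
  to be chosen.\<close>

definition e :: "nat \<Rightarrow> 'a" where
  "e j = (1 / 2) *\<^sub>R (f m - f (m - 1)) + (\<Sum>k=j..<m. f k)"

lemma e_Suc: "j < m \<Longrightarrow> e j = f j + e (Suc j)"
  by (simp add: e_def sum.atLeast_Suc_lessThan)

lemma f_e: "j < m \<Longrightarrow> f j = e j - e (Suc j)"
  by (simp add: e_Suc)

lemma f_m: "f m = e (m - 1) + e m"
proof -
  have "e (m - 1) = f (m - 1) + e m" using e_Suc[of "m - 1"] m3 by simp
  moreover have "e m + e m = f m - f (m - 1)"
    by (simp add: e_def flip: scaleR_2)
  ultimately show ?thesis by (simp add: algebra_simps)
qed

lemma cartan_f:
  "i \<in> {1..m} \<Longrightarrow> j \<in> {1..m} \<Longrightarrow> cartan (f i) (f j) =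
    (if i = j then 2 else if edge_D m i j \<or> edge_D m j i then - 1 else 0)"
  using dynkin_enum_cartan[OF enum] .

lemma cartan_e:
  assumes i: "i \<in> {1..m}" and "1 \<le> j" "j \<le> m"
  shows "cartan (e j) (f i) =
    (if i = j \<or> i = m \<and> Suc j = m then 1 else if Suc i = j \<and> j \<le> m then - 1 else 0)"
  using assms(3,2)
proof (induction j rule: inc_induct)
  case base
  have "cartan (e m) (f i) = (cartan (f m) (f i) - cartan (f (m - 1)) (f i)) / 2"
    by (simp add: e_def cartan_scaleR cartan_diff)
  moreover have "cartan (f m) (f i) = (if m = i then 2 else if i + 2 = m then - 1 else 0)"
    using cartan_f[of m i] i m3 by (auto simp: edge_D_def)
  moreover have "cartan (f (m - 1)) (f i) = (if Suc i = m then 2 else if i + 2 = m then - 1 else 0)"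
    using cartan_f[of "m - 1" i] i m3 by (auto simp: edge_D_def)
  ultimately show ?case using i m3 by auto
next
  case (step j)
  have "cartan (f j) (f i) = (if i = j then 2
      else if Suc j = i \<and> i < m \<or> Suc i = j \<or> j + 2 = m \<and> i = m then - 1 else 0)"
    using cartan_f[of j i] i step m3 by (auto simp: edge_D_def)
  then show ?case using step i m3 by (auto simp: e_Suc cartan_add)
qed

lemma refl_e:
  assumes "i \<in> {1..m}" "j \<in> {1..m}" "i < m"
  shows "refl_root (f i) (e j) = (if i = j then e (Suc j) else if Suc i = j then e i else e j)"
  using cartan_e[OF assms(1), of j] assms by (auto simp: refl_root_def f_e)

lemma refl_e_m:
  assumes "j \<in> {1..m}"
  shows "refl_root (f m) (e j) = (if j = m then - e (m - 1) else if Suc j = m then - e m else e j)"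
  using cartan_e[of m j] assms m3 by (auto simp: refl_root_def f_m)

text \<open>The vectors are told apart by their Cartan numbers; \<open>f m\<close> is what separates
  \<open>e (m - 1)\<close> from \<open>- e m\<close>.\<close>

lemma e_distinct:
  assumes "i \<in> {1..m}" "j \<in> {1..m}"
  shows "e i = e j \<longleftrightarrow> i = j" "e i \<noteq> - e j"
proof -
  have *: "e i \<noteq> e j \<and> e i \<noteq> - e j" if "i < j" "i \<in> {1..m}" "j \<in> {1..m}" for i j
  proof -
    have "cartan (e i) (f i) = 1" "cartan (e j) (f i) = (if Suc i = j then - 1 else 0)"
      "cartan (e i) (f j) = (if j = m \<and> Suc i = m then 1 else 0)" "cartan (e j) (f j) = 1"
      "cartan (e i) (f m) = (if Suc i = m then 1 else 0)"
      "cartan (e j) (f m) = (if j = m \<or> Suc j = m then 1 else 0)"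
      using that m3 by (auto simp: cartan_e)
    then show ?thesis using that by (auto simp: cartan_minus split: if_splits)
  qed
  have "e i \<noteq> - e i" if "i \<in> {1..m}" for i
  proof
    assume "e i = - e i"
    then have "cartan (e i) (f i) = - cartan (e i) (f i)" by (metis cartan_minus)
    then show False using that by (simp add: cartan_e)
  qed
  with * show "e i = e j \<longleftrightarrow> i = j" "e i \<noteq> - e j"
    using assms by (metis linorder_neqE_nat minus_minus)+
qed

section \<open>The Coxeter product of type D as a negacycle\<close>

lemma upt_m: "[1..<Suc m] = [1..<m - 1] @ [m - 1, m]"
proof -
  have "[1..<Suc m] = [1..<m - 1] @ (m - 1) # [m..<Suc m]"
    using m3 upt_split[of 1 "m - 1" "Suc m"] by simp
  then show ?thesis by simp
qed

abbreviation (input) c :: "'a \<Rightarrow> 'a" where "c \<equiv> cox_prod (map f [1..<Suc m])"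

text \<open>The two fork reflections together negate \<open>e (m - 1)\<close> and
  \<open>e m\<close>. The remaining factors cycle \<open>e 1\<close>, ..., \<open>e (m - 1)\<close>,
  so the sign turns this cycle into a negacycle of twice the length.\<close>

lemma c_apply: "c v = cox_prod (map f [1..<m - 1]) (refl_root (f (m - 1)) (refl_root (f m) v))"
  unfolding upt_m by (simp add: cox_prod_append cox_prod_Cons cox_prod_Nil)

lemma cox_minus: "cox_prod ds (- v) = - cox_prod ds v"
  using linear_cox_prod by (rule linear_neg)

lemma c_e:
  assumes "j \<in> {1..<m - 1}"
  shows "c (e j) = e (Suc j)"
proof -
  have "[1..<m - 1] = [1..<j] @ j # [Suc j..<m - 1]"
    using assms by (intro upt_split) auto
  moreover have "refl_root (f m) (e j) = e j" "refl_root (f (m - 1)) (e j) = e j"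
    using assms refl_e_m refl_e by auto
  moreover have "cox_prod (map f [Suc j..<m - 1]) (e j) = e j"
    using assms refl_e by (intro cox_prod_fix) auto
  moreover have "cox_prod (map f [1..<j]) (e (Suc j)) = e (Suc j)"
    using assms refl_e by (intro cox_prod_fix) auto
  moreover have "j < m" using assms by auto
  ultimately show ?thesis using refl_e[of j j] assms
    unfolding c_apply by (simp add: cox_prod_append cox_prod_Cons)
qed

lemma cox_prod_e: "1 \<le> j \<Longrightarrow> j < m \<Longrightarrow> cox_prod (map f [1..<j]) (e j) = e 1"
proof (induction j rule: nat_induct_at_least)
  case base
  then show ?case by (simp add: cox_prod_Nil)
next
  case (Suc j)
  have "[1..<Suc j] = [1..<j] @ [j]" using Suc by simp
  then show ?case using Suc refl_e[of j "Suc j"]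
    by (simp add: cox_prod_append cox_prod_Cons cox_prod_Nil)
qed

lemma c_e_m1: "c (e (m - 1)) = - e 1"
proof -
  have "refl_root (f m) (e (m - 1)) = - e m" "refl_root (f (m - 1)) (- e m) = - e (m - 1)"
    using refl_e_m[of "m - 1"] refl_e[of "m - 1" m] m3 by (auto simp: refl_root_minus)
  then show ?thesis unfolding c_apply using cox_prod_e[of "m - 1"] m3 by (simp add: cox_minus)
qed

lemma c_e_m: "c (e m) = - e m"
proof -
  have "refl_root (f m) (e m) = - e (m - 1)" "refl_root (f (m - 1)) (- e (m - 1)) = - e m"
    using refl_e_m[of m] refl_e[of "m - 1" "m - 1"] m3 by (auto simp: refl_root_minus)
  moreover have "refl_root (f i) (e m) = e m" if "i \<in> {1..<m - 1}" for i
  proof -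
    have "i < m" "i \<noteq> m" "Suc i \<noteq> m" using that by auto
    then show ?thesis using refl_e[of i m] that m3 by simp
  qed
  then have "cox_prod (map f [1..<m - 1]) (e m) = e m"
    by (intro cox_prod_fix) auto
  ultimately show ?thesis unfolding c_apply by (simp add: cox_minus)
qed

text \<open>The orbit of \<open>e 1\<close> under the product: \<open>e 1\<close>, ...,
  \<open>e (m - 1)\<close>, followed by their negatives in the same order.\<close>

definition p :: "nat \<Rightarrow> 'a" where
  "p k = (if k < m - 1 then e (Suc k) else - e (Suc k - (m - 1)))"

lemma cox_order: "c ^^ d = id \<longleftrightarrow> 2 * (m - 1) dvd d"
proof (rule cox_prod_order[where p = p and V = "e ` {1..m}"])
  show cyc: "c (p k) = p (Suc k mod (2 * (m - 1)))" if k: "k < 2 * (m - 1)" for k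
  proof -
    \<comment> \<open>The second case is the turn from \<open>e (m - 1)\<close> to
      \<open>- e 1\<close>, the fourth closes the cycle from \<open>- e (m - 1)\<close> to
      \<open>e 1\<close>; the other two move one place within a half.\<close>
    consider "k + 2 < m" | "k + 2 = m" | "m - 1 \<le> k" "k < 2 * (m - 1) - 1" | "k = 2 * (m - 1) - 1"
      using k by linarith
    then show ?thesis
    proof cases
      case 1
      then have "c (e (Suc k)) = e (Suc (Suc k))" using c_e[of "Suc k"] by simp
      moreover have "k < m - 1" "Suc k < m - 1" "Suc k mod (2 * (m - 1)) = Suc k" using 1 by simp_all
      ultimately show ?thesis by (simp only: p_def if_True)
    next
      case 2
      then have "m - 1 = Suc k" by simp
      then have "c (e (Suc k)) = - e 1" using c_e_m1 by (simp del: upt_Suc)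
      moreover have "k < m - 1" "\<not> Suc k < m - 1" "Suc k mod (2 * (m - 1)) = Suc k"
        "Suc (Suc k) - (m - 1) = 1" using 2 by auto
      ultimately show ?thesis by (simp only: p_def if_True if_False)
    next
      case 3
      have "Suc k - (m - 1) \<in> {1..<m - 1}" "Suc (Suc k - (m - 1)) = Suc (Suc k) - (m - 1)"
        using 3 by auto
      then have "c (e (Suc k - (m - 1))) = e (Suc (Suc k) - (m - 1))" using c_e by metis
      moreover have "\<not> k < m - 1" "\<not> Suc k < m - 1" "Suc k mod (2 * (m - 1)) = Suc k" using 3 by auto
      ultimately show ?thesis by (simp only: p_def if_False cox_minus)
    next
      case 4
      then have "Suc k = 2 * (m - 1)" using m3 by simp
      then have "Suc k - (m - 1) = m - 1" "\<not> k < m - 1" "Suc k mod (2 * (m - 1)) = 0" "0 < m - 1" 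
        using m3 by (simp_all add: 4)
      then show ?thesis using c_e_m1 by (simp only: p_def if_False if_True cox_minus minus_minus One_nat_def)
    qed
  qed
  show "inj_on p {..<2 * (m - 1)}"
  proof (rule inj_onI)
    fix k l assume kl: "k \<in> {..<2 * (m - 1)}" "l \<in> {..<2 * (m - 1)}" and eq: "p k = p l"
    have lo: "Suc i \<in> {1..m}" if "i < m - 1" for i using that by auto
    have hi: "Suc i - (m - 1) \<in> {1..m}" if "\<not> i < m - 1" "i \<in> {..<2 * (m - 1)}" for i
      using that by auto
    consider "k < m - 1" "l < m - 1" | "k < m - 1" "\<not> l < m - 1" | "\<not> k < m - 1" "l < m - 1"
      | "\<not> k < m - 1" "\<not> l < m - 1" by blast
    then show "k = l"
    proof cases
      case 1
      then show ?thesis using eq e_distinct(1)[OF lo lo, of k l] by (simp add: p_def)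
    next
      case 2
      then show ?thesis using eq e_distinct(2)[OF lo hi[OF _ kl(2)], of k] by (simp add: p_def)
    next
      case 3
      then show ?thesis using eq e_distinct(2)[OF lo hi[OF _ kl(1)], of l] by (simp add: p_def)
    next
      case 4
      then show ?thesis using eq e_distinct(1)[OF hi[OF _ kl(1)] hi[OF _ kl(2)]] by (simp add: p_def)
    qed
  qed
  show "set (map f [1..<Suc m]) \<subseteq> span (e ` {1..m})"
  proof
    fix x assume "x \<in> set (map f [1..<Suc m])"
    then obtain i where i: "x = f i" "i \<in> {1..m}" by auto
    have e: "e j \<in> span (e ` {1..m})" if "j \<in> {1..m}" for j using that by (intro span_base) blast
    show "x \<in> span (e ` {1..m})"
    proof (cases "i = m")
      case True
      then show ?thesis using i f_m m3 e[of "m - 1"] e[of m] by (simp add: span_add)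
    next
      case False
      then show ?thesis using i f_e[of i] e[of i] e[of "Suc i"] by (simp add: span_diff)
    qed
  qed
  show "(c ^^ (2 * (m - 1))) v = v" if v: "v \<in> e ` {1..m}" for v
  proof -
    obtain j where j: "v = e j" "j \<in> {1..m}" using v by blast
    show ?thesis
    proof (cases "j = m")
      case True
      \<comment> \<open>\<open>e m\<close> lies outside the cycle. The product negates it, and the
        exponent is even.\<close>
      have "(c ^^ (2 * n)) (e m) = e m" for n
      proof (induction n)
        case (Suc n)
        have "(c ^^ (2 * Suc n)) (e m) = c (c ((c ^^ (2 * n)) (e m)))" by simp
        then show ?case using Suc c_e_m by (simp add: cox_minus del: upt_Suc)
      qed simp
      then show ?thesis using j True by blast
    next
      case False
      then have k: "v = p (j - 1)" "j - 1 < 2 * (m - 1)" using j by (auto simp: p_def)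
      then show ?thesis
        using funpow_cycle[of "2 * (m - 1)" c p "j - 1" "2 * (m - 1)"] cyc
        by (simp only: mod_add_self2 mod_less)
    qed
  qed
qed (use m3 in simp)

lemma coxeter_number_D:
  assumes "root_system \<Phi>" "simple_system \<Phi> (f ` {1..m})"
  shows "coxeter_number \<Phi> = 2 * (m - 1)"
proof (rule coxeter_number_enum[OF assms enum _ cox_order])
  fix k
  \<comment> \<open>The last vertex hangs on m - 2; every other vertex k > 1 has k - 1 as its
    smaller neighbour.\<close>
  show "\<exists>b. \<forall>i\<in>{1..<k}. edge_D m i k \<or> edge_D m k i \<longrightarrow> i = b"
    by (intro exI[of _ "if k = m then m - 2 else k - 1"]) (auto simp: edge_D_def)
qed

section \<open>Cosets in type D\<close>

definition P :: "nat \<Rightarrow> 'a \<Rightarrow> 'a" where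
  "P k = cox_prod (rev (map f [1..<k]))"

text \<open>The orbit of \<open>e 1\<close> consists of all coordinate vectors and their negatives.
  \<open>P k\<close> carries \<open>e 1\<close> to \<open>e k\<close>; \<open>Q k\<close> climbs to
  \<open>e (m - 1)\<close>, crosses to \<open>- e m\<close> by the reflection in \<open>f m\<close>,
  and descends to \<open>- e k\<close>.\<close>

definition Q :: "nat \<Rightarrow> 'a \<Rightarrow> 'a" where
  "Q k = cox_prod (map f [k..<m]) \<circ> (refl_root (f m) \<circ> P (m - 1))"

lemma P_1: "P 1 = id" and P_Suc: "1 \<le> k \<Longrightarrow> P (Suc k) = refl_root (f k) \<circ> P k"
  by (simp_all add: P_def cox_prod_Nil cox_prod_Cons)

lemma Q_m: "Q m = refl_root (f m) \<circ> P (m - 1)"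
  by (simp add: Q_def cox_prod_Nil)

lemma Q_Suc: "k < m \<Longrightarrow> Q k = refl_root (f k) \<circ> Q (Suc k)"
  by (simp add: Q_def upt_conv_Cons cox_prod_Cons comp_assoc)

text \<open>The fork reflections commute, so there is a second crossing from the family
  \<open>P\<close> to the family \<open>Q\<close>: \<open>P (m - 1)\<close> leads to
  \<open>Q m\<close>, and \<open>P m\<close> leads to \<open>Q (m - 1)\<close>.\<close>

lemma Q_m1: "Q (m - 1) = refl_root (f m) \<circ> P m"
proof -
  have m: "m = Suc (m - 1)" using m3 by simp
  have "f m \<bullet> f (m - 1) = 0"
    using dynkin_enum_inner[OF enum, of m "m - 1"] m3 by (auto simp: edge_D_def)
  then have "refl_root (f m) \<circ> refl_root (f (m - 1)) = refl_root (f (m - 1)) \<circ> refl_root (f m)"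
    by (rule refl_root_commute)
  moreover have "P m = refl_root (f (m - 1)) \<circ> P (m - 1)" using m3 P_Suc[of "m - 1"] m by simp
  moreover have "Q (m - 1) = refl_root (f (m - 1)) \<circ> (refl_root (f m) \<circ> P (m - 1))"
    using Q_Suc[of "m - 1"] m m3 Q_m by simp
  ultimately show ?thesis by (metis comp_assoc)
qed

lemma P_refl_group: "1 \<le> k \<Longrightarrow> k \<le> m \<Longrightarrow> P k \<in> refl_group (f ` {1..m})"
proof (induction k rule: nat_induct_at_least)
  case base
  show ?case unfolding P_1 by (rule refl_group_id)
next
  case (Suc k)
  show ?case unfolding P_Suc[OF Suc(1)] using Suc by (intro refl_group_refl) auto
qed

lemma Q_refl_group: "k \<le> m \<Longrightarrow> 1 \<le> k \<Longrightarrow> Q k \<in> refl_group (f ` {1..m})"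
proof (induction k rule: inc_induct)
  case base
  show ?case unfolding Q_m using m3 by (intro refl_group_refl P_refl_group) auto
next
  case (step k)
  show ?case unfolding Q_Suc[OF step(2)] using step by (intro refl_group_refl) auto
qed

lemma P_e:
  "1 \<le> k \<Longrightarrow> k \<le> m \<Longrightarrow> i \<in> {1..m} \<Longrightarrow>
    P k (e i) = (if i = 1 then e k else if i \<le> k then e (i - 1) else e i)"
proof (induction k rule: nat_induct_at_least)
  case base
  then show ?case unfolding P_1 by auto
next
  case (Suc k)
  obtain l where l: "i = Suc l" using Suc.prems by (cases i) auto
  consider "l < k" | "l = k" | "k < l" by linarith
  then show ?case unfolding P_Suc[OF Suc(1)] l
    using Suc l refl_e[of k k] refl_e[of k l] refl_e[of k "Suc l"] by cases auto
qed

text \<open>In type D signs change in pairs. The sign needed to send \<open>e 1\<close> to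
  \<open>- e k\<close> is compensated by one on the image of \<open>e m\<close>.\<close>

lemma Q_e:
  "k \<le> m \<Longrightarrow> 1 \<le> k \<Longrightarrow> i \<in> {1..m} \<Longrightarrow>
    Q k (e i) = (if i = 1 then - e k else
      (if i = m then - 1 else 1) *\<^sub>R (if i \<le> k then e (i - 1) else e i))"
proof (induction k rule: inc_induct)
  case base
  obtain l where l: "i = Suc l" using base by (cases i) auto
  consider "l = 0" | "0 < l" "Suc l < m" | "Suc l = m" using base l by fastforce
  then show ?case
  proof cases
    case 1
    then show ?thesis unfolding Q_m using l m3 refl_e_m[of "m - 1"] P_e[of "m - 1" 1] by simp
  next
    case 2
    then have "Suc l \<le> m - 1" by simp
    then show ?thesis unfolding Q_m using 2 l m3 refl_e_m[of l] P_e[of "m - 1" "Suc l"] by simp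
  next
    case 3
    then show ?thesis unfolding Q_m using l m3 refl_e_m[of m] P_e[of "m - 1" m] by auto
  qed
next
  case (step k)
  obtain l where l: "i = Suc l" using step.prems by (cases i) auto
  consider "l < k" | "l = k" | "k < l" by linarith
  then show ?case unfolding Q_Suc[OF step(2)] l
    using step l m3 refl_e[of k "Suc k"] refl_e[of k l] refl_e[of k "Suc l"]
    by cases (auto simp: refl_root_minus)
qed

lemma P_f:
  assumes k: "1 \<le> k" "k \<le> m" and j: "j \<in> {1..m}"
  shows "Suc j < k \<Longrightarrow> P k (f (Suc j)) = f j" "k < j \<Longrightarrow> j < m \<Longrightarrow> P k (f j) = f j"
    "Suc k < m \<Longrightarrow> P k (f m) = f m"
proof -
  have lin: "linear (P k)" unfolding P_def by (rule linear_cox_prod)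
  show "Suc j < k \<Longrightarrow> P k (f (Suc j)) = f j" "k < j \<Longrightarrow> j < m \<Longrightarrow> P k (f j) = f j"
    "Suc k < m \<Longrightarrow> P k (f m) = f m"
    using k j m3 by (auto simp: f_e f_m linear_diff[OF lin] linear_add[OF lin] P_e)
qed

text \<open>The sign on the image of \<open>e m\<close> distinguishes this from the case of
  \<open>P\<close>: the fork ends are exchanged when k < m - 1, and for k = m the root sent to
  \<open>f (m - 2)\<close> is \<open>f m\<close> instead of \<open>f (m - 1)\<close>.\<close>

lemma Q_f:
  assumes k: "1 \<le> k" "k \<le> m" and j: "j \<in> {1..m}"
  shows "Suc j < k \<Longrightarrow> Suc (Suc j) < m \<Longrightarrow> Q k (f (Suc j)) = f j"
    "Suc j < k \<Longrightarrow> Suc (Suc j) = m \<Longrightarrow> Q k (f m) = f j"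
    "k < j \<Longrightarrow> Suc j < m \<Longrightarrow> Q k (f j) = f j"
    "Suc k < m \<Longrightarrow> Q k (f m) = f (m - 1)"
    "Suc k < m \<Longrightarrow> Q k (f (m - 1)) = f m"
proof -
  have lin: "linear (Q k)"
    unfolding Q_def P_def by (intro linear_compose linear_cox_prod linear_refl_root)
  show "Suc j < k \<Longrightarrow> Suc (Suc j) < m \<Longrightarrow> Q k (f (Suc j)) = f j"
    "Suc j < k \<Longrightarrow> Suc (Suc j) = m \<Longrightarrow> Q k (f m) = f j"
    "k < j \<Longrightarrow> Suc j < m \<Longrightarrow> Q k (f j) = f j"
    "Suc k < m \<Longrightarrow> Q k (f m) = f (m - 1)"
    "Suc k < m \<Longrightarrow> Q k (f (m - 1)) = f m"
    using k j m3 by (auto simp: f_e f_m linear_diff[OF lin] linear_add[OF lin] Q_e)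
qed

lemma card_refl_group_step: "card (refl_group (f ` {1..m})) = 2 * m * card (refl_group (f ` {2..m}))"
proof -
  define T where "T = (\<lambda>(b, k). if b then P k else Q k)"
  let ?I = "(UNIV :: bool set) \<times> {1..m}" and ?H = "refl_group (f ` {2..m})"
  have T_refl_group: "T i \<in> refl_group (f ` {1..m})" if "i \<in> ?I" for i
  proof -
    obtain b k where "i = (b, k)" "k \<in> {1..m}" using \<open>i \<in> ?I\<close> by blast
    then show ?thesis using P_refl_group[of k] Q_refl_group[of k] by (cases b) (simp_all add: T_def)
  qed
  \<comment> \<open>A generator has two possible effects on a coset. \<open>pass\<close> moves it
    through the representative into the stabiliser and keeps the coset; \<open>jump\<close> lands
    exactly on another representative.\<close>
  have pass: "\<exists>i\<in>?I. \<exists>h\<in>?H. refl_root (f j) \<circ> T (b, k) = T i \<circ> h"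
    if "k \<in> {1..m}" "T (b, k) (f l) = f j" "l \<in> {2..m}" for j k l b
  proof -
    have "orthogonal_transformation (T (b, k))" using T_refl_group that(1) refl_group_orthogonal by blast
    then have "refl_root (f j) \<circ> T (b, k) = T (b, k) \<circ> refl_root (f l)"
      using refl_root_comp_orthogonal[of "T (b, k)" "f l"] that(2) by simp
    then show ?thesis using that refl_group_gen by blast
  qed
  have jump: "\<exists>i\<in>?I. \<exists>h\<in>?H. refl_root (f j) \<circ> T (b, k) = T i \<circ> h"
    if "l \<in> {1..m}" "refl_root (f j) \<circ> T (b, k) = T (b', l)" for j k l b b'
  proof -
    have "refl_root (f j) \<circ> T (b, k) = T (b', l) \<circ> id" using that(2) by (simp only: comp_id)
    then show ?thesis using that(1) refl_group_id by blast
  qed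
  have invol: "refl_root \<gamma> \<circ> (refl_root \<gamma> \<circ> g) = g" for \<gamma> and g :: "'a \<Rightarrow> 'a"
    by (simp only: comp_assoc[symmetric] refl_root_comp_invol id_comp)
  have "card (refl_group (f ` {1..m})) = card ?I * card ?H"
  proof (rule card_refl_group_transversal[where x = "e 1" and T = T and ?i0.0 = "(True, 1)"])
    show "f ` {2..m} \<subseteq> f ` {1..m}" by auto
    show "T (True, 1) = id" using P_1 by (simp add: T_def)
    show "(True, 1) \<in> ?I" using m3 by simp
    show "inj_on (\<lambda>i. T i (e 1)) ?I"
    proof (rule inj_onI, clarify)
      fix b k b' l
      assume "T (b, k) (e 1) = T (b', l) (e 1)" and kl: "k \<in> {1..m}" "l \<in> {1..m}"
      then have "(if b then e k else - e k) = (if b' then e l else - e l)"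
        using m3 by (auto simp: T_def P_e Q_e split: if_splits)
      then show "b = b' \<and> k = l"
        using e_distinct[OF kl] e_distinct(2)[OF kl(2,1)] by (cases b; cases b') auto
    qed
    show "refl_root s (e 1) = e 1" if s: "s \<in> f ` {2..m}" for s
    proof -
      obtain i where "s = f i" "i \<in> {2..m}" using s by blast
      then show ?thesis using refl_e[of i 1] refl_e_m[of 1] m3 by (cases "i = m") auto
    qed
    fix s i assume "s \<in> f ` {1..m}" "i \<in> ?I"
    then obtain j b k where j: "s = f j" "j \<in> {1..m}" and k: "i = (b, k)" "k \<in> {1..m}" by blast
    have cases: "j < m \<or> j = m" "j = k \<or> Suc j = k \<or> Suc j < k \<or> k < j"
      "Suc k < m \<or> Suc k = m \<or> k = m" "Suc j < k \<Longrightarrow> Suc (Suc j) < m \<or> Suc (Suc j) = m"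
      "j < m \<Longrightarrow> Suc j < m \<or> Suc j = m"
      using j k by auto
    show "\<exists>i'\<in>?I. \<exists>h\<in>?H. refl_root s \<circ> T i = T i' \<circ> h"
    proof (cases b)
      case True
      have b: "T (b, k) = P k" for k by (simp add: T_def True)
      \<comment> \<open>The last three cases concern the reflection in \<open>f m\<close>: it keeps
        the coset for k < m - 1 and crosses to the family \<open>Q\<close> for k = m - 1 and k =
        m.\<close>
      consider "j < m" "j = k" | "j < m" "Suc j = k" | "j < m" "Suc j < k" | "j < m" "k < j"
        | "j = m" "Suc k < m" | "j = m" "Suc k = m" | "j = m" "k = m"
        using cases by blast
      then show ?thesis unfolding k(1) j(1)
      proof cases
        case 1
        then have "refl_root (f j) \<circ> T (b, k) = T (b, Suc k)" using k P_Suc[of k] by (simp add: b)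
        with 1 show "\<exists>i'\<in>?I. \<exists>h\<in>?H. refl_root (f j) \<circ> T (b, k) = T i' \<circ> h"
          by (intro jump[of "Suc k"]) auto
      next
        case 2
        moreover have "P (Suc j) = refl_root (f j) \<circ> P j" using j by (intro P_Suc) auto
        ultimately have "refl_root (f j) \<circ> T (b, k) = T (b, j)" using invol by (metis b)
        then show "\<exists>i'\<in>?I. \<exists>h\<in>?H. refl_root (f j) \<circ> T (b, k) = T i' \<circ> h"
          using j by (intro jump[of j]) auto
      next
        case 3
        then show "\<exists>i'\<in>?I. \<exists>h\<in>?H. refl_root (f j) \<circ> T (b, k) = T i' \<circ> h"
          using j k P_f(1)[of k j] by (intro pass[of k _ "Suc j"]) (simp_all add: b)
      next
        case 4
        then show "\<exists>i'\<in>?I. \<exists>h\<in>?H. refl_root (f j) \<circ> T (b, k) = T i' \<circ> h"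
          using j k P_f(2)[of k j] by (intro pass[of k _ j]) (simp_all add: b)
      next
        case 5
        then show "\<exists>i'\<in>?I. \<exists>h\<in>?H. refl_root (f j) \<circ> T (b, k) = T i' \<circ> h"
          using j k P_f(3)[of k j] by (intro pass[of k _ m]) (simp_all add: b)
      next
        case 6
        then have "k = m - 1" by simp
        then have "refl_root (f j) \<circ> T (b, k) = T (False, m)"
          using Q_m 6 True by (simp add: T_def)
        then show "\<exists>i'\<in>?I. \<exists>h\<in>?H. refl_root (f j) \<circ> T (b, k) = T i' \<circ> h"
          using m3 by (intro jump[of m]) auto
      next
        case 7
        then have "refl_root (f j) \<circ> T (b, k) = T (False, m - 1)"
          using Q_m1 7 True by (simp add: T_def)
        then show "\<exists>i'\<in>?I. \<exists>h\<in>?H. refl_root (f j) \<circ> T (b, k) = T i' \<circ> h"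
          using m3 by (intro jump[of "m - 1"]) auto
      qed
    next
      case False
      have b: "T (b, k) = Q k" for k by (simp add: T_def False)
      consider "j < m" "j = k" | "j < m" "Suc j = k" | "j < m" "Suc j < k" "Suc (Suc j) < m"
        | "Suc j < k" "Suc (Suc j) = m" | "Suc j < m" "k < j" | "Suc j = m" "k < j"
        | "j = m" "Suc k < m" | "j = m" "Suc k = m" | "j = m" "k = m"
        using cases by blast
      then show ?thesis unfolding k(1) j(1)
      proof cases
        case 1
        then have "refl_root (f j) \<circ> T (b, k) = T (b, Suc k)"
          using k Q_Suc[of k] invol by (simp only: b)
        with 1 show "\<exists>i'\<in>?I. \<exists>h\<in>?H. refl_root (f j) \<circ> T (b, k) = T i' \<circ> h"
          by (intro jump[of "Suc k"]) auto
      next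
        case 2
        then have "refl_root (f j) \<circ> T (b, k) = T (b, j)" using Q_Suc[of j] by (simp only: b)
        then show "\<exists>i'\<in>?I. \<exists>h\<in>?H. refl_root (f j) \<circ> T (b, k) = T i' \<circ> h"
          using j by (intro jump[of j]) auto
      next
        case 3
        then show "\<exists>i'\<in>?I. \<exists>h\<in>?H. refl_root (f j) \<circ> T (b, k) = T i' \<circ> h"
          using j k Q_f(1)[of k j] by (intro pass[of k _ "Suc j"]) (simp_all add: b)
      next
        case 4
        then show "\<exists>i'\<in>?I. \<exists>h\<in>?H. refl_root (f j) \<circ> T (b, k) = T i' \<circ> h"
          using j k Q_f(2)[of k j] by (intro pass[of k _ m]) (simp_all add: b)
      next
        case 5
        then show "\<exists>i'\<in>?I. \<exists>h\<in>?H. refl_root (f j) \<circ> T (b, k) = T i' \<circ> h"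
          using j k Q_f(3)[of k j] by (intro pass[of k _ j]) (simp_all add: b)
      next
        case 6
        then have "j = m - 1" by simp
        then show "\<exists>i'\<in>?I. \<exists>h\<in>?H. refl_root (f j) \<circ> T (b, k) = T i' \<circ> h"
          using 6 j k Q_f(4)[of k j] m3 by (intro pass[of k _ m]) (simp_all add: b)
      next
        case 7
        then show "\<exists>i'\<in>?I. \<exists>h\<in>?H. refl_root (f j) \<circ> T (b, k) = T i' \<circ> h"
          using j k Q_f(5)[of k j] m3 by (intro pass[of k _ "m - 1"]) (auto simp: b)
      next
        case 8
        then have "k = m - 1" by simp
        then have "refl_root (f j) \<circ> T (b, k) = T (True, m)"
          using Q_m1 8 False invol by (simp add: T_def)
        then show "\<exists>i'\<in>?I. \<exists>h\<in>?H. refl_root (f j) \<circ> T (b, k) = T i' \<circ> h"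
          using m3 by (intro jump[of m]) auto
      next
        case 9
        then have "refl_root (f j) \<circ> T (b, k) = T (True, m - 1)"
          using Q_m 9 False invol by (simp add: T_def)
        then show "\<exists>i'\<in>?I. \<exists>h\<in>?H. refl_root (f j) \<circ> T (b, k) = T i' \<circ> h"
          using m3 by (intro jump[of "m - 1"]) auto
      qed
    qed
  qed (use T_refl_group in blast)
  then show ?thesis by (simp add: card_cartesian_product)
qed

end

section \<open>Orthogonal components and positivity of the orders\<close>

text \<open>A root orthogonal to all others contributes a direct factor of order 2. In the coset
  criterion the root itself is the test vector: the other reflections fix it and its own negates
  it.\<close>

lemma card_refl_group_insert_orthogonal:
  assumes "a \<noteq> 0" "\<And>s. s \<in> S \<Longrightarrow> s \<bullet> a = 0"
  shows "card (refl_group (insert a S)) = 2 * card (refl_group S)"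
proof -
  let ?T = "\<lambda>b. if b then id else refl_root a"
  have "card (refl_group (insert a S)) = card (UNIV :: bool set) * card (refl_group S)"
  proof (rule card_refl_group_transversal[where x = a and T = ?T and ?i0.0 = True])
    show "refl_root s a = a" if "s \<in> S" for s
      using assms(2)[OF that] by (simp add: refl_root_fix inner_commute)
    have "a \<noteq> - a"
    proof
      assume "a = - a"
      then have "2 *\<^sub>R a = 0" by (metis add.right_inverse scaleR_2)
      with assms(1) show False by simp
    qed
    then show "inj_on (\<lambda>b. ?T b a) UNIV"
      by (auto simp: inj_on_def refl_root_self split: if_splits)
    show "?T b \<in> refl_group (insert a S)" for b by (simp only: refl_group_id refl_group_gen insertI1 split: if_split) blast
  next
    fix s b assume "s \<in> insert a S"
    then consider "s = a" | "s \<in> S" by blast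
    then show "\<exists>b'\<in>UNIV. \<exists>h\<in>refl_group S. refl_root s \<circ> ?T b = ?T b' \<circ> h"
    proof cases
      case 1
      then have "refl_root s \<circ> ?T b = ?T (\<not> b) \<circ> id"
        by (cases b) (simp_all only: refl_root_comp_invol comp_id if_True if_False simp_thms)
      then show ?thesis using refl_group_id by blast
    next
      case 2
      then have "refl_root s \<circ> ?T b = ?T b \<circ> refl_root s"
        using refl_root_commute[OF assms(2)] by (cases b) (simp_all only: id_comp comp_id if_True if_False)
      then show ?thesis using refl_group_gen 2 by blast
    qed
  qed auto
  then show ?thesis by simp
qed

lemma image_Suc_shift: "f ` {Suc l..Suc m} = (\<lambda>i. f (Suc i)) ` {l..m}"
  by (simp only: image_image[of f Suc, symmetric] image_Suc_atLeastAtMost)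

lemma dynkin_enum_D_shift:
  "dynkin_enum (edge_D (Suc m)) (Suc m) f \<Longrightarrow> dynkin_enum (edge_D m) m (\<lambda>i. f (Suc i))"
  by (simp add: dynkin_enum_def edge_D_def)

text \<open>\<open>card\<close> is 0 on infinite sets, and then the coset formula carries no
  information. Positivity permits cancelling in the quotient of orders. The induction starts at D_2,
  two orthogonal roots.\<close>

lemma card_refl_group_D_pos:
  "2 \<le> m \<Longrightarrow> dynkin_enum (edge_D m) m f \<Longrightarrow> 0 < card (refl_group (f ` {1..m}))"
proof (induction m arbitrary: f rule: nat_induct_at_least)
  case base
  have "f ` {1..2} = insert (f 1) (insert (f 2) {})" by (auto simp: numeral_2_eq_2 le_Suc_eq)
  moreover have "f 2 \<bullet> f 1 = 0"
    using dynkin_enum_inner[OF base, of 2 1] by (simp add: edge_D_def)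
  ultimately show ?case
    using card_refl_group_insert_orthogonal[of "f 1" "{f 2}"] card_refl_group_insert_orthogonal[of "f 2" "{}"]
      dynkin_enum_nonzero[OF base] by (simp add: refl_group_empty)
next
  case (Suc m)
  interpret enum_D f "Suc m" using Suc by unfold_locales auto
  show ?case
    using card_refl_group_step Suc.IH[OF dynkin_enum_D_shift[OF Suc.prems]] image_Suc_shift[of f 1 m]
    by (simp add: numeral_2_eq_2)
qed

section \<open>The identity\<close>

lemma dynkin_enum_reindex:
  assumes "dynkin_enum E m f" "\<And>i. i \<in> {1..k} \<Longrightarrow> \<pi> i \<in> {1..m}" "inj_on \<pi> {1..k}"
    and "\<And>i j. i \<in> {1..k} \<Longrightarrow> j \<in> {1..k} \<Longrightarrow> E (\<pi> i) (\<pi> j) \<or> E (\<pi> j) (\<pi> i) \<longleftrightarrow> E' i j \<or> E' j i"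
  shows "dynkin_enum E' k (f \<circ> \<pi>)"
  unfolding dynkin_enum_def comp_apply
proof (intro ballI)
  fix i j assume ij: "i \<in> {1..k}" "j \<in> {1..k}"
  have "\<pi> i = \<pi> j \<longleftrightarrow> i = j" using inj_onD[OF assms(3)] ij by blast
  then show "cartan (f (\<pi> i)) (f (\<pi> j)) = (if i = j then 2 else if E' i j \<or> E' j i then - 1 else 0)"
    using dynkin_enum_cartan[OF assms(1) assms(2)[OF ij(1)] assms(2)[OF ij(2)]] assms(4)[OF ij]
    by simp
qed

text \<open>The type is witnessed by some simple system, while the leaf belongs to the given
  \<open>\<Delta>\<close>. An orthogonal map between the two preserves Cartan numbers and carries
  the numbering over.\<close>

lemma simply_laced_enum:
  assumes "root_system \<Phi>" "simple_system \<Phi> \<Delta>" "simply_laced_type E n \<Phi>"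
  obtains f where "f ` {1..n} = \<Delta>" "dynkin_enum E n f"
proof -
  obtain \<Delta>0 f where f: "simple_system \<Phi> \<Delta>0" "bij_betw f {1..n} \<Delta>0" "dynkin_enum E n f"
    using assms(3) unfolding simply_laced_type_def dynkin_enum_def by blast
  obtain w where w: "orthogonal_transformation w" "w ` \<Delta>0 = \<Delta>"
    using simple_systems_conj[OF assms(1) f(1) assms(2)] by blast
  have "(w \<circ> f) ` {1..n} = \<Delta>" using f(2) w(2) by (simp only: bij_betw_def image_comp[symmetric])
  moreover have "dynkin_enum E n (w \<circ> f)"
    using f(3) orthogonal_cartan[OF w(1)] by (simp add: dynkin_enum_def)
  ultimately show ?thesis using that by blast
qed

lemma dynkin_leaf_enum:
  assumes f: "dynkin_enum E n f" and leaf: "dynkin_leaf (f ` {1..n}) (f k)" and k: "k \<in> {1..n}"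
    and i: "i \<in> {1..n}" "i \<noteq> k" "E i k \<or> E k i" and j: "j \<in> {1..n}" "j \<noteq> k" "E j k \<or> E k j"
  shows "i = j"
proof (rule ccontr)
  assume "i \<noteq> j"
  let ?N = "{\<beta> \<in> f ` {1..n}. \<beta> \<noteq> f k \<and> \<beta> \<bullet> f k \<noteq> 0}"
  have inj: "f a = f b \<longleftrightarrow> a = b" if "a \<in> {1..n}" "b \<in> {1..n}" for a b
    using dynkin_enum_inj[OF f] that by (auto dest: inj_onD)
  have "{f i, f j} \<subseteq> ?N"
    using i j dynkin_enum_inner[OF f i(1) k] dynkin_enum_inner[OF f j(1) k] inj k by auto
  then have "card {f i, f j} \<le> card ?N" by (intro card_mono) auto
  moreover have "card {f i, f j} = 2" using \<open>i \<noteq> j\<close> inj i j by simp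
  ultimately show False using leaf by (simp add: dynkin_leaf_def)
qed

lemma enum_minus_closed_nbhd:
  assumes f: "dynkin_enum E n f" and k: "k \<in> {1..n}"
  shows "f ` {1..n} - closed_nbhd (f ` {1..n}) (f k) = f ` {i \<in> {1..n}. i \<noteq> k \<and> \<not> E i k \<and> \<not> E k i}"
proof -
  have "f i \<in> closed_nbhd (f ` {1..n}) (f k) \<longleftrightarrow> i = k \<or> E i k \<or> E k i" if "i \<in> {1..n}" for i
    using that dynkin_enum_inner[OF f that k] by (auto simp: closed_nbhd_def)
  then show ?thesis by blast
qed

lemma enum_minus_single:
  assumes "dynkin_enum E n f" "k \<in> {1..n}"
  shows "f ` {1..n} - {f k} = f ` ({1..n} - {k})"
  using inj_on_image_set_diff[OF dynkin_enum_inj[OF assms(1)], of "{1..n}" "{k}"] assms(2) by auto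

lemma coxeter_number_subsystem_A:
  assumes "root_system \<Phi>" "simple_system \<Phi> \<Delta>" "g ` {1..m} \<subseteq> \<Delta>" "dynkin_enum edge_A m g"
  shows "coxeter_number (generated_subsystem \<Phi> (g ` {1..m})) = m + 1"
proof -
  have simple: "simple_system (\<Phi> \<inter> span (g ` {1..m})) (g ` {1..m})"
    using simple_system_Int_span assms by blast
  interpret enum_A g m using assms simple by unfold_locales (auto simp: simple_system_def)
  show ?thesis
    unfolding generated_subsystem_eq[OF assms(1,2,3)]
    using coxeter_number_A[OF root_system_Int_span[OF assms(1)] simple] .
qed

lemma coxeter_number_subsystem_D:
  assumes "root_system \<Phi>" "simple_system \<Phi> \<Delta>" "g ` {1..m} \<subseteq> \<Delta>" "dynkin_enum (edge_D m) m g" "3 \<le> m"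
  shows "coxeter_number (generated_subsystem \<Phi> (g ` {1..m})) = 2 * (m - 1)"
proof -
  have simple: "simple_system (\<Phi> \<inter> span (g ` {1..m})) (g ` {1..m})"
    using simple_system_Int_span assms by blast
  interpret enum_D g m using assms by unfold_locales auto
  show ?thesis
    unfolding generated_subsystem_eq[OF assms(1,2,3)]
    using coxeter_number_D[OF root_system_Int_span[OF assms(1)] simple] .
qed

section \<open>The identity at each kind of leaf\<close>

context
  fixes \<Phi> \<Delta> :: "'a::euclidean_space set" and f :: "nat \<Rightarrow> 'a" and n :: nat
  assumes root: "root_system \<Phi>" and simple: "simple_system \<Phi> \<Delta>" and f: "f ` {1..n} = \<Delta>"
begin

abbreviation (input) identity_at :: "'a \<Rightarrow> bool" where
  "identity_at \<alpha> \<equiv> real (coxeter_number \<Phi>) * real n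
           - real (coxeter_number (generated_subsystem \<Phi> (\<Delta> - {\<alpha>}))) * (real n - 1)
         = 2 * (real (card (weyl_omit \<Delta> {\<alpha>})) / real (card (weyl_omit \<Delta> (closed_nbhd \<Delta> \<alpha>))))"

lemma independent_simple: "independent (f ` I)" if "I \<subseteq> {1..n}"
  using simple f independent_mono[of \<Delta> "f ` I"] image_mono[OF that, of f]
  by (simp add: simple_system_def)

lemma identity_A_end:
  assumes enum: "dynkin_enum edge_A n f" and n: "1 \<le> n"
  shows "identity_at (f n)"
proof -
  have enum': "dynkin_enum edge_A m f" if "m \<le> n" for m
    using enum that by (auto simp: dynkin_enum_def)
  interpret enum_A f n using enum independent_simple by unfold_locales auto
  have h: "coxeter_number \<Phi> = n + 1" using coxeter_number_A root simple f by blast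
  have "\<Delta> - {f n} = f ` ({1..n} - {n})" using enum_minus_single[OF enum, of n] n f by simp
  moreover have "{1..n} - {n} = {1..n - 1}" using n by auto
  ultimately have D1: "\<Delta> - {f n} = f ` {1..n - 1}" by simp
  \<comment> \<open>For n = 1 the subsystem is empty and its only Coxeter element is
    \<open>id\<close>, of order 1; the factor n - 1 then makes the term 0.\<close>
  have h1: "coxeter_number (generated_subsystem \<Phi> (\<Delta> - {f n})) = n"
    using coxeter_number_subsystem_A[OF root simple, of f "n - 1"] enum'[of "n - 1"] D1 n by auto
  have "\<Delta> - closed_nbhd \<Delta> (f n) = f ` {i \<in> {1..n}. i \<noteq> n \<and> \<not> edge_A i n \<and> \<not> edge_A n i}"
    using enum_minus_closed_nbhd[OF enum, of n] n f by simp
  moreover have "{i \<in> {1..n}. i \<noteq> n \<and> \<not> edge_A i n \<and> \<not> edge_A n i} = {1..n - 2}"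
    by (auto simp: edge_A_def)
  ultimately have D2: "\<Delta> - closed_nbhd \<Delta> (f n) = f ` {1..n - 2}" by simp
  have c1: "card (refl_group (f ` {1..n - 1})) = fact n"
    using card_refl_group_A[of "n - 1" f] enum'[of "n - 1"] independent_simple[of "{1..n - 1}"] n by auto
  have c2: "card (refl_group (f ` {1..n - 2})) = fact (n - 2 + 1)"
    using card_refl_group_A[of "n - 2" f] enum'[of "n - 2"] independent_simple[of "{1..n - 2}"] by auto
  \<comment> \<open>Truncated subtraction makes \<open>n - 2 + 1\<close> equal to 1 for n = 1, where
    both factorials are 1 and the quotient is still n.\<close>
  have "real (fact n) / real (fact (n - 2 + 1)) = real n"
  proof (cases "n = 1")
    case False
    then have "n - 2 + 1 = n - 1" using n by simp
    then show ?thesis using n by (simp add: fact_reduce[of n])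
  qed simp
  then have "real (card (weyl_omit \<Delta> {f n})) / real (card (weyl_omit \<Delta> (closed_nbhd \<Delta> (f n)))) = real n"
    by (simp only: weyl_omit_eq D1 D2 c1 c2)
  then show ?thesis by (simp add: h h1 algebra_simps)
qed

text \<open>Removing the tail leaves D_m with m = n - 1, and the neighbour of the leaf becomes
  vertex 1 of that diagram. The quotient of orders is therefore the index 2 m from the coset step,
  whatever the orders themselves are.\<close>

lemma identity_D_tail:
  assumes enum: "dynkin_enum (edge_D n) n f" and n: "4 \<le> n"
  shows "identity_at (f 1)"
proof -
  obtain m where m: "n = Suc m" "3 \<le> m" using n by (cases n) auto
  define g where "g = (\<lambda>i. f (Suc i))"
  have enum_g: "dynkin_enum (edge_D m) m g"
    using dynkin_enum_D_shift enum unfolding m g_def by blast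
  interpret F: enum_D f n using enum n by unfold_locales auto
  interpret G: enum_D g m using enum_g m by unfold_locales auto
  have h: "coxeter_number \<Phi> = 2 * m" using F.coxeter_number_D root simple f m by auto
  have "\<Delta> - {f 1} = f ` ({1..n} - {1})" using enum_minus_single[OF enum, of 1] n f by simp
  moreover have "{1..n} - {1} = {Suc 1..Suc m}" using m by auto
  ultimately have D1: "\<Delta> - {f 1} = g ` {1..m}" using image_Suc_shift[of f 1 m] by (simp add: g_def)
  then have h1: "coxeter_number (generated_subsystem \<Phi> (\<Delta> - {f 1})) = 2 * (m - 1)"
    using coxeter_number_subsystem_D[OF root simple, of g m] enum_g m by auto
  have "\<Delta> - closed_nbhd \<Delta> (f 1) = f ` {i \<in> {1..n}. i \<noteq> 1 \<and> \<not> edge_D n i 1 \<and> \<not> edge_D n 1 i}"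
    using enum_minus_closed_nbhd[OF enum, of 1] n f by simp
  moreover have "{i \<in> {1..n}. i \<noteq> 1 \<and> \<not> edge_D n i 1 \<and> \<not> edge_D n 1 i} = {Suc 2..Suc m}"
    using n m by (auto simp: edge_D_def)
  ultimately have D2: "\<Delta> - closed_nbhd \<Delta> (f 1) = g ` {2..m}"
    using image_Suc_shift[of f 2 m] by (simp add: g_def)
  have "0 < card (refl_group (g ` {1..m}))" using card_refl_group_D_pos[OF _ enum_g] m by simp
  then have pos: "0 < card (refl_group (g ` {2..m}))" using G.card_refl_group_step by (metis mult_0_right neq0_conv)
  then have "real (card (weyl_omit \<Delta> {f 1})) / real (card (weyl_omit \<Delta> (closed_nbhd \<Delta> (f 1)))) = 2 * real m"
    unfolding weyl_omit_eq D1 D2 G.card_refl_group_step by simp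
  then show ?thesis unfolding h h1 m(1) using m(2) by (simp add: of_nat_diff algebra_simps)
qed

text \<open>Removing a fork end leaves a path of n - 1 vertices. Removing its neighbour n - 2 as
  well leaves a path of n - 3 vertices and the isolated other fork end, which accounts for the
  factor 2 in the denominator.\<close>

lemma identity_D_fork:
  assumes enum: "dynkin_enum (edge_D n) n f" and n: "4 \<le> n"
  shows "identity_at (f n)"
proof -
  interpret F: enum_D f n using enum n by unfold_locales auto
  have enum': "dynkin_enum edge_A m f" if "m < n" for m
    using enum that by (auto simp: dynkin_enum_def edge_A_def edge_D_def)
  have h: "coxeter_number \<Phi> = 2 * (n - 1)" using F.coxeter_number_D root simple f by auto
  have "\<Delta> - {f n} = f ` ({1..n} - {n})" using enum_minus_single[OF enum, of n] n f by simp
  moreover have "{1..n} - {n} = {1..n - 1}" using n by auto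
  ultimately have D1: "\<Delta> - {f n} = f ` {1..n - 1}" by simp
  have h1: "coxeter_number (generated_subsystem \<Phi> (\<Delta> - {f n})) = n"
    using coxeter_number_subsystem_A[OF root simple, of f "n - 1"] enum'[of "n - 1"] D1 n by auto
  have "\<Delta> - closed_nbhd \<Delta> (f n) = f ` {i \<in> {1..n}. i \<noteq> n \<and> \<not> edge_D n i n \<and> \<not> edge_D n n i}"
    using enum_minus_closed_nbhd[OF enum, of n] n f by simp
  moreover have "{i \<in> {1..n}. i \<noteq> n \<and> \<not> edge_D n i n \<and> \<not> edge_D n n i} = insert (n - 1) {1..n - 3}"
    using n by (auto simp: edge_D_def)
  ultimately have D2: "\<Delta> - closed_nbhd \<Delta> (f n) = insert (f (n - 1)) (f ` {1..n - 3})" by simp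
  have c1: "card (refl_group (f ` {1..n - 1})) = fact n"
    using card_refl_group_A[of "n - 1" f] enum'[of "n - 1"] independent_simple[of "{1..n - 1}"] n by auto
  have "s \<bullet> f (n - 1) = 0" if s: "s \<in> f ` {1..n - 3}" for s
  proof -
    obtain i where "s = f i" "i \<in> {1..n - 3}" using s by blast
    then show ?thesis using dynkin_enum_inner[OF enum, of i "n - 1"] n by (auto simp: edge_D_def)
  qed
  then have "card (refl_group (insert (f (n - 1)) (f ` {1..n - 3}))) = 2 * card (refl_group (f ` {1..n - 3}))"
    using dynkin_enum_nonzero[OF enum, of "n - 1"] n by (intro card_refl_group_insert_orthogonal) auto
  moreover have "card (refl_group (f ` {1..n - 3})) = fact (n - 3 + 1)"
    using card_refl_group_A[of "n - 3" f] enum'[of "n - 3"] independent_simple[of "{1..n - 3}"] n by auto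
  moreover have "n - 3 + 1 = n - 2" using n by simp
  ultimately have c2: "card (refl_group (insert (f (n - 1)) (f ` {1..n - 3}))) = 2 * fact (n - 2)"
    by (simp only:)
  obtain m where m: "n = Suc (Suc m)" using n by (cases n rule: nat.exhaust; cases "n - 1") auto
  have "real (card (weyl_omit \<Delta> {f n})) / real (card (weyl_omit \<Delta> (closed_nbhd \<Delta> (f n))))
    = real (fact n) / real (2 * fact (n - 2))"
    by (simp only: weyl_omit_eq D1 D2 c1 c2)
  also have "\<dots> = real n * (real n - 1) / 2" by (simp add: m field_simps)
  finally show ?thesis unfolding h h1 using n by (simp add: of_nat_diff algebra_simps)
qed

end

lemma image_reindex: "\<pi> ` A = A \<Longrightarrow> (f \<circ> \<pi>) ` A = f ` A"
  by (metis image_comp)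

theorem corollary8p3:
  fixes \<Phi> \<Delta> :: "'a::euclidean_space set" and \<alpha> :: 'a and n :: nat
  assumes "root_system \<Phi>"
    and "type_A n \<Phi> \<or> type_D n \<Phi>"
    and "simple_system \<Phi> \<Delta>"
    and "dynkin_leaf \<Delta> \<alpha>"
  shows "real (coxeter_number \<Phi>) * real n
           - real (coxeter_number (generated_subsystem \<Phi> (\<Delta> - {\<alpha>}))) * (real n - 1)
         = 2 * (real (card (weyl_omit \<Delta> {\<alpha>})) / real (card (weyl_omit \<Delta> (closed_nbhd \<Delta> \<alpha>))))"
proof (cases "type_A n \<Phi>")
  case True
  then have n: "1 \<le> n" and "simply_laced_type edge_A n \<Phi>"
    by (auto simp: type_A_def edge_A_def[abs_def])
  then obtain f where f: "f ` {1..n} = \<Delta>" "dynkin_enum edge_A n f"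
    using simply_laced_enum assms by metis
  obtain k where k: "k \<in> {1..n}" "\<alpha> = f k" using assms(4) f(1) by (auto simp: dynkin_leaf_def)
  have "k = 1 \<or> k = n"
  proof (rule ccontr)
    assume *: "\<not> (k = 1 \<or> k = n)"
    \<comment> \<open>An inner vertex has the neighbours k - 1 and k + 1, which the leaf condition
      would force to coincide.\<close>
    then have "k - 1 = k + 1"
      using assms(4) k f(1) by (intro dynkin_leaf_enum[OF f(2), of k]) (auto simp: edge_A_def)
    then show False by simp
  qed
  then show ?thesis
  proof
    assume "k = n"
    then show ?thesis using identity_A_end[OF assms(1,3) f n] k(2) by simp
  next
    assume "k = 1"
    \<comment> \<open>Reversing the path is a diagram automorphism that moves the first end to the
      last.\<close>
    define \<pi> where "\<pi> i = n + 1 - i" for i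
    have inj: "inj_on \<pi> {1..n}" by (auto simp: \<pi>_def inj_on_def)
    have im: "\<pi> ` {1..n} = {1..n}"
      using inj by (intro endo_inj_surj) (auto simp: \<pi>_def)
    have "dynkin_enum edge_A n (f \<circ> \<pi>)"
      by (rule dynkin_enum_reindex[OF f(2) _ inj]) (auto simp: \<pi>_def edge_A_def)
    then show ?thesis
      using identity_A_end[OF assms(1,3), of "f \<circ> \<pi>" n] image_reindex[OF im, of f] f(1) n k(2) \<open>k = 1\<close>
      by (simp add: \<pi>_def)
  qed
next
  case False
  then have n: "4 \<le> n" and "simply_laced_type (edge_D n) n \<Phi>"
    using assms(2) by (auto simp: type_D_def edge_D_def[abs_def])
  then obtain f where f: "f ` {1..n} = \<Delta>" "dynkin_enum (edge_D n) n f"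
    using simply_laced_enum assms by metis
  obtain k where k: "k \<in> {1..n}" "\<alpha> = f k" using assms(4) f(1) by (auto simp: dynkin_leaf_def)
  have "k = 1 \<or> k = n \<or> k = n - 1"
  proof (rule ccontr)
    assume *: "\<not> (k = 1 \<or> k = n \<or> k = n - 1)"
    then have "k - 1 = k + 1"
      using assms(4) k n f(1) by (intro dynkin_leaf_enum[OF f(2), of k]) (auto simp: edge_D_def)
    then show False by simp
  qed
  then consider "k = 1" | "k = n" | "k = n - 1" by blast
  then show ?thesis
  proof cases
    case 1
    then show ?thesis using identity_D_tail[OF assms(1,3) f n] k(2) by simp
  next
    case 2
    then show ?thesis using identity_D_fork[OF assms(1,3) f n] k(2) by simp
  next
    case 3
    \<comment> \<open>Exchanging the two fork ends is a diagram automorphism and reduces the leaf n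
      - 1 to the leaf n.\<close>
    define \<pi> where "\<pi> i = (if i = n then n - 1 else if i = n - 1 then n else i)" for i
    have inj: "inj_on \<pi> {1..n}" using n by (auto simp: \<pi>_def inj_on_def)
    have im: "\<pi> ` {1..n} = {1..n}"
      using inj n by (intro endo_inj_surj) (auto simp: \<pi>_def)
    have "dynkin_enum (edge_D n) n (f \<circ> \<pi>)"
    proof (rule dynkin_enum_reindex[OF f(2) _ inj])
      show "\<pi> i \<in> {1..n}" if "i \<in> {1..n}" for i using that im by blast
      show "edge_D n (\<pi> i) (\<pi> j) \<or> edge_D n (\<pi> j) (\<pi> i) \<longleftrightarrow> edge_D n i j \<or> edge_D n j i"
        if "i \<in> {1..n}" "j \<in> {1..n}" for i j
        using that n by (auto simp: \<pi>_def edge_D_def)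
    qed
    then show ?thesis
      using identity_D_fork[OF assms(1,3), of "f \<circ> \<pi>" n] image_reindex[OF im, of f] f(1) n k(2) 3
      by (simp add: \<pi>_def)
  qed
qed

end
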